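(* Let $\mathcal{S}=\{S_1,\ldots,S_r\}$ be a finite subset of $\mathrm{GL}(n,\mathbb{F})$ such that $G=\langle\mathcal{S}\rangle$ is nilpotent. Let $\gamma$ be the integer such that $p^{\gamma-1}<n\le p^{\gamma}$, and let $\mathcal{S}'=\{S_i^{p^\gamma}\mid 1\le i\le r\}$. Choose any $\mathcal{S}'$-admissible $\alpha$, let $\nu$ be the positive integer with $\mathbb{F}_q(\alpha)=\mathbb{F}_{q^\nu}$, and carry out the following procedure. (1) If two distinct elements of $\mathcal{S}'$ have the same image under $\varphi_\alpha$, return `false'. (2) Construct an $\mathbb{F}_{q^\nu}$-basis $A_1(\alpha),\ldots,A_d(\alpha)$ of $\langle \varphi_\alpha(\langle\mathcal{S}'\rangle)\rangle_{\mathbb{F}_{q^\nu}}$ as follows: start with the set $\mathcal{A}(\alpha)=\{I_n\}$; while there exist $A\in\mathcal{A}(\alpha)$ and $T\in\varphi_\alpha(\mathcal{S}')$ with $AT\notin\mathrm{span}_{\mathbb{F}_{q^\nu}}(\mathcal{A}(\alpha))$, adjoin $AT$ to $\mathcal{A}(\alpha)$. Each $A_k(\alpha)$ is thus obtained as a word $T_1(\alpha)\cdots T_t(\alpha)$ with $T_1,\ldots,T_t\in\mathcal{S}'$ (the empty word for $I_n$); put $A_k=T_1\cdots T_t$. (3) For each $k\in\{1,\ldots,d\}$ and each $T\in\mathcal{S}'$, find the $a_1,\ldots,a_d\in\mathbb{F}_{q^\nu}$ such that $A_k(\alpha)T(\alpha)=\sum_{l=1}^d a_lA_l(\alpha)$;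 if $A_kT\neq\sum_{l=1}^d a_lA_l$, return `false'. (4) Return `true'. This procedure returns `true' if $G$ is finite and `false' if $G$ is infinite.
   Context: $q$ is a power of the prime $p$, $m,n\ge1$, and $\mathbb{F}=\mathbb{F}_q(X_1,\ldots,X_m)$ is the field of rational functions in algebraically independent indeterminates. All finite extensions $\mathbb{F}_{q^\nu}$ of $\mathbb{F}_q$ are taken in a fixed algebraic closure $\overline{\mathbb{F}}_q$. For a finite set $\mathcal{T}\subseteq\mathrm{GL}(n,\mathbb{F})$, let $f\in\mathbb{F}_q[X_1,\ldots,X_m]$ be a (non-zero) common multiple of the denominators of the non-zero entries of $T$ and $T^{-1}$, $T\in\mathcal{T}$. A tuple $\alpha=(\alpha_1,\ldots,\alpha_m)\in\overline{\mathbb{F}}_q^{\,m}$ is $\mathcal{T}$-admissible if $f(\alpha)\ne0$. For such $\alpha$, $\varphi_\alpha$ denotes substitution of $\alpha_i$ for $X_i$ ($1\le i\le m$) in the entries of matrices over $\mathbb{F}_q[X_1,\ldots,X_m][1/f]$ (a ring containing all the entries of elements of $\langle\mathcal{T}\rangle$); we write $M(\alpha)=\varphi_\alpha(M)$. $\mathbb{F}_q(\alpha)=\mathbb{F}_q(\alpha_1,\ldots,\alpha_m)$. For a group $H$ of matrices over a field containing $\mathbb{K}$, $\langle H\rangle_{\mathbb{K}}$ is its enveloping algebra, i.e. the $\mathbb{K}$-span of $H$. Equations such as $A_kT=\sum a_lA_l$ are understood over $\mathbb{F}_{q^\nu}(X_1,\ldots,X_m)$. *)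

theory Defs
  imports
    "HOL-Analysis.Cartesian_Space"
    "HOL-Algebra.Generated_Groups"
    "HOL-Algebra.Generated_Fields"
    "HOL-Algebra.Algebraic_Closure_Type"
    "HOL-Computational_Algebra.Fraction_Field"
    "HOL-Library.Poly_Mapping"
    "HOL-Number_Theory.Residues"
begin

no_notation fps_nth (infixl \<open>$\<close> 75)

definition GL :: "('a::field ^ 'n ^ 'n) monoid" where
  "GL = \<lparr>carrier = {A. invertible A}, monoid.mult = (**), one = mat 1\<rparr>"

lemma group_GL: "group (GL :: ('a::field ^ 'n ^ 'n) monoid)"
proof (rule groupI)
  fix A :: "'a ^ 'n ^ 'n" assume "A \<in> carrier GL"
  then show "\<exists>B\<in>carrier GL. B \<otimes>\<^bsub>GL\<^esub> A = \<one>\<^bsub>GL\<^esub>"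
    by (auto simp: GL_def invertible_def)
qed (auto simp: GL_def matrix_mul_assoc intro: invertible_mult exI[of _ "mat 1"] simp: invertible_def[of "mat 1"])

fun lower_central :: "('a, 'b) monoid_scheme \<Rightarrow> nat \<Rightarrow> 'a set" where
  "lower_central G 0 = carrier G"
| "lower_central G (Suc i) =
     generate G (\<Union>x\<in>lower_central G i. \<Union>y\<in>carrier G.
       {x \<otimes>\<^bsub>G\<^esub> y \<otimes>\<^bsub>G\<^esub> inv\<^bsub>G\<^esub> x \<otimes>\<^bsub>G\<^esub> inv\<^bsub>G\<^esub> y})"

definition nilpotent_group :: "('a, 'b) monoid_scheme \<Rightarrow> bool" where
  "nilpotent_group G \<longleftrightarrow> group G \<and> (\<exists>c. lower_central G c = {\<one>\<^bsub>G\<^esub>})"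

text \<open>
  Polynomials in indeterminates indexed by \<^typ>\<open>'m\<close>: finitely supported maps from exponent
  vectors to coefficients. The linear order on \<^typ>\<open>'m\<close> only serves to make the library
  provide the integral domain instance. The finite index type plays the role of
  $\{1,\ldots,m\}$.
\<close>

type_synonym ('m, 'k) mpoly = "('m \<Rightarrow>\<^sub>0 nat) \<Rightarrow>\<^sub>0 'k"
type_synonym ('m, 'k) ratfun = "('m, 'k) mpoly fract"

definition map_coeffs :: "('k \<Rightarrow> 'l) \<Rightarrow> ('m, 'k::zero) mpoly \<Rightarrow> ('m, 'l::zero) mpoly" where
  "map_coeffs h P = Poly_Mapping.map h P"

definition const_ratfun :: "'k::idom \<Rightarrow> ('m::linorder, 'k) ratfun" where
  "const_ratfun c = Fract (Poly_Mapping.single 0 c) 1"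

definition poly_at :: "('m::finite, 'k::field) mpoly \<Rightarrow> ('m \<Rightarrow> 'k alg_closure) \<Rightarrow> 'k alg_closure" where
  "poly_at P \<alpha> =
     (\<Sum>e\<in>Poly_Mapping.keys P. to_ac (Poly_Mapping.lookup P e) * (\<Prod>i\<in>UNIV. \<alpha> i ^ Poly_Mapping.lookup e i))"

lemma mpoly_induct [case_names single sum]:
  fixes P :: "'a \<Rightarrow>\<^sub>0 'b::monoid_add"
  assumes "\<And>e c. R (Poly_Mapping.single e c)" "\<And>f g. R f \<Longrightarrow> R g \<Longrightarrow> R (f + g)"
  shows "R P"
proof (induction P rule: update_induct)
  case const
  show ?case using assms(1)[of undefined 0] by simp
next
  case (update f a b)
  have "Poly_Mapping.update a b f = f + Poly_Mapping.single a b"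
    using update by (intro poly_mapping_eqI)
      (auto simp: Poly_Mapping.lookup_update lookup_add lookup_single when_def in_keys_iff)
  then show ?case using assms update by simp
qed

lemma lookup_map_coeffs: "h 0 = 0 \<Longrightarrow> Poly_Mapping.lookup (map_coeffs h P) e = h (Poly_Mapping.lookup P e)"
  by (simp add: map_coeffs_def Poly_Mapping.map.rep_eq when_def)

lemma map_coeffs_to_ac_add:
  "map_coeffs to_ac (P + Q) = map_coeffs to_ac P + map_coeffs to_ac Q"
  by (rule poly_mapping_eqI) (simp add: lookup_map_coeffs lookup_add)

lemma map_coeffs_to_ac_single:
  "map_coeffs to_ac (Poly_Mapping.single e c) = Poly_Mapping.single e (to_ac c)"
  by (rule poly_mapping_eqI) (simp add: lookup_map_coeffs lookup_single when_def)

lemma map_coeffs_to_ac_mult: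
  fixes P Q :: "('m, 'k::field) mpoly"
  shows "map_coeffs to_ac (P * Q) = map_coeffs to_ac P * map_coeffs to_ac Q"
proof (induction P rule: mpoly_induct)
  case (single e c)
  show ?case
    by (induction Q rule: mpoly_induct)
       (simp_all add: mult_single map_coeffs_to_ac_single map_coeffs_to_ac_add distrib_left)
next
  case (sum f g)
  then show ?case by (simp add: map_coeffs_to_ac_add distrib_right)
qed

lemma map_coeffs_to_ac_eq_0_iff [simp]: "map_coeffs to_ac P = 0 \<longleftrightarrow> P = 0"
  by (auto simp: poly_mapping_eq_iff fun_eq_iff lookup_map_coeffs)

lemma poly_at_superset:
  assumes "finite E" "Poly_Mapping.keys P \<subseteq> E"
  shows "poly_at P \<alpha> =
     (\<Sum>e\<in>E. to_ac (Poly_Mapping.lookup P e) * (\<Prod>i\<in>UNIV. \<alpha> i ^ Poly_Mapping.lookup e i))"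
  unfolding poly_at_def using assms
  by (intro sum.mono_neutral_left) (auto simp: in_keys_iff)

lemma poly_at_add: "poly_at (P + Q) \<alpha> = poly_at P \<alpha> + poly_at Q \<alpha>"
proof -
  let ?E = "Poly_Mapping.keys P \<union> Poly_Mapping.keys Q"
  have "Poly_Mapping.keys (P + Q) \<subseteq> ?E" by (rule Poly_Mapping.keys_add)
  then show ?thesis
    by (simp add: poly_at_superset[of ?E] lookup_add distrib_right sum.distrib)
qed

lemma poly_at_single:
  "poly_at (Poly_Mapping.single e c) \<alpha> = to_ac c * (\<Prod>i\<in>UNIV. \<alpha> i ^ Poly_Mapping.lookup e i)"
  by (subst poly_at_superset[of "{e}"]) auto

lemma poly_at_mult: "poly_at (P * Q) \<alpha> = poly_at P \<alpha> * poly_at Q \<alpha>"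
proof (induction P rule: mpoly_induct)
  case (single e c)
  show ?case
  proof (induction Q rule: mpoly_induct)
    case (single e' c')
    then show ?case
      by (simp add: mult_single poly_at_single lookup_add power_add prod.distrib mult_ac)
  next
    case (sum f g)
    then show ?case by (simp add: poly_at_add distrib_left)
  qed
next
  case (sum f g)
  then show ?case by (simp add: poly_at_add distrib_right)
qed

text \<open>The inclusion of $\mathbb{F}_q(X_1,\ldots,X_m)$ in $\overline{\mathbb{F}}_q(X_1,\ldots,X_m)$.\<close>

definition ratfun_to_ac :: "('m::linorder, 'k::field) ratfun \<Rightarrow> ('m, 'k alg_closure) ratfun" where
  "ratfun_to_ac x =
     (THE y. \<exists>a b. x = Fract a b \<and> b \<noteq> 0 \<and> y = Fract (map_coeffs to_ac a) (map_coeffs to_ac b))"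

lemma ratfun_to_ac_Fract:
  assumes "b \<noteq> 0"
  shows "ratfun_to_ac (Fract a b) = Fract (map_coeffs to_ac a) (map_coeffs to_ac b)"
  unfolding ratfun_to_ac_def
proof (rule the_equality)
  fix y assume "\<exists>c d. Fract a b = Fract c d \<and> d \<noteq> 0 \<and>
    y = Fract (map_coeffs to_ac c) (map_coeffs to_ac d)"
  then obtain c d where cd: "Fract a b = Fract c d" "d \<noteq> 0"
    "y = Fract (map_coeffs to_ac c) (map_coeffs to_ac d)"
    by blast
  then have "a * d = c * b" using assms by (simp add: eq_fract)
  then show "y = Fract (map_coeffs to_ac a) (map_coeffs to_ac b)"
    using assms cd(2,3) by (simp add: eq_fract flip: map_coeffs_to_ac_mult)
qed (use assms in auto)

text \<open>
  Substitution of \<open>\<alpha>\<close> for the indeterminates. It is meaningful for those rational functions that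
  have a denominator not vanishing at \<open>\<alpha>\<close>; in particular, if \<open>f(\<alpha>) \<noteq> 0\<close>, on the ring
  $\mathbb{F}_q[X_1,\ldots,X_m][1/f]$.
\<close>

definition ratfun_at ::
    "('m::{finite,linorder}, 'k::field) ratfun \<Rightarrow> ('m \<Rightarrow> 'k alg_closure) \<Rightarrow> 'k alg_closure" where
  "ratfun_at x \<alpha> =
     (THE y. \<exists>a b. x = Fract a b \<and> poly_at b \<alpha> \<noteq> 0 \<and> y = poly_at a \<alpha> / poly_at b \<alpha>)"

lemma ratfun_at_Fract:
  assumes "poly_at b \<alpha> \<noteq> 0"
  shows "ratfun_at (Fract a b) \<alpha> = poly_at a \<alpha> / poly_at b \<alpha>"
  unfolding ratfun_at_def
proof (rule the_equality)
  fix y assume "\<exists>c d. Fract a b = Fract c d \<and> poly_at d \<alpha> \<noteq> 0 \<and> y = poly_at c \<alpha> / poly_at d \<alpha>"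
  then obtain c d where cd: "Fract a b = Fract c d" "poly_at d \<alpha> \<noteq> 0" "y = poly_at c \<alpha> / poly_at d \<alpha>"
    by blast
  have "b \<noteq> 0" "d \<noteq> 0" using assms cd(2) by (auto simp: poly_at_def)
  then have "a * d = c * b" using cd(1) by (simp add: eq_fract)
  then have "poly_at a \<alpha> * poly_at d \<alpha> = poly_at c \<alpha> * poly_at b \<alpha>"
    by (simp flip: poly_at_mult)
  then show "y = poly_at a \<alpha> / poly_at b \<alpha>"
    using assms cd(2,3) by (simp add: frac_eq_eq)
qed (use assms in auto)

definition mat_at ::
    "('m::{finite,linorder}, 'k::field) ratfun ^ 'n ^ 'n \<Rightarrow> ('m \<Rightarrow> 'k alg_closure) \<Rightarrow> 'k alg_closure ^ 'n ^ 'n"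
  where "mat_at M \<alpha> = (\<chi> i j. ratfun_at (M $ i $ j) \<alpha>)"

definition mat_to_ac ::
    "('m::linorder, 'k::field) ratfun ^ 'n ^ 'n \<Rightarrow> ('m, 'k alg_closure) ratfun ^ 'n ^ 'n"
  where "mat_to_ac M = (\<chi> i j. ratfun_to_ac (M $ i $ j))"

definition common_denominator ::
    "(('m::linorder, 'k::field) ratfun ^ 'n ^ 'n) set \<Rightarrow> ('m, 'k) mpoly \<Rightarrow> bool" where
  "common_denominator \<T> f \<longleftrightarrow> f \<noteq> 0 \<and>
     (\<forall>T\<in>\<T>. \<forall>M\<in>{T, matrix_inv T}. \<forall>i j. M $ i $ j \<noteq> 0 \<longrightarrow>
        (\<exists>a b. b \<noteq> 0 \<and> M $ i $ j = Fract a b \<and> b dvd f))"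

definition admissible ::
    "(('m::{finite,linorder}, 'k::field) ratfun ^ 'n ^ 'n) set \<Rightarrow> ('m \<Rightarrow> 'k alg_closure) \<Rightarrow> bool" where
  "admissible \<T> \<alpha> \<longleftrightarrow> (\<exists>f. common_denominator \<T> f \<and> poly_at f \<alpha> \<noteq> 0)"

definition adjoin_tuple :: "('m \<Rightarrow> 'k::field alg_closure) \<Rightarrow> 'k alg_closure set" where
  "adjoin_tuple \<alpha> = generate_field ring_of_type_algebra (range to_ac \<union> range \<alpha>)"

text \<open>$\mathbb{F}_{q^\nu}$ for $q$ the number of elements of \<^typ>\<open>'k\<close>.\<close>

definition Fq_ext :: "nat \<Rightarrow> 'k::{field,finite} alg_closure set" where
  "Fq_ext \<nu> = (THE K. subfield K ring_of_type_algebra \<and> card K = CARD('k) ^ \<nu>)"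

text \<open>The defining description determines a unique subfield.\<close>

lemma Fq_ext:
  fixes p e \<nu> :: nat
  assumes "prime p" "CARD('k::{field,finite}) = p ^ e" "\<nu> > 0"
  defines "N \<equiv> CARD('k) ^ \<nu>"
  shows "Fq_ext \<nu> = {x :: 'k alg_closure. x ^ N = x}"
    and "subfield (Fq_ext \<nu> :: 'k alg_closure set) ring_of_type_algebra"
    and "card (Fq_ext \<nu> :: 'k alg_closure set) = N"
proof -
  define R where "R = (ring_of_type_algebra :: 'k alg_closure ring)"
  interpret R: field R unfolding R_def by (rule field_from_type_algebra)
  have R_simps [simp]: "carrier R = UNIV" "\<one>\<^bsub>R\<^esub> = 1" "\<zero>\<^bsub>R\<^esub> = 0"
    "x \<otimes>\<^bsub>R\<^esub> y = x * y" "x \<oplus>\<^bsub>R\<^esub> y = x + y" for x y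
    by (simp_all add: R_def ring_of_type_algebra_def)
  have minus [simp]: "\<ominus>\<^bsub>R\<^esub> x = - x" for x
    by (rule R.minus_equality) auto
  have inv [simp]: "inv\<^bsub>R\<^esub> x = inverse x" if "x \<noteq> 0" for x
    using that by (intro R.comm_inv_char) auto
  have "CHAR('k) dvd p ^ e" using CHAR_dvd_CARD[where 'a = 'k] assms(2) by simp
  moreover have "prime CHAR('k)"
    by (rule prime_CHAR_semidom) (rule finite_imp_CHAR_pos, simp)
  ultimately have "CHAR('k) = p" using assms(1) prime_dvd_power primes_dvd_imp_eq by blast
  then have CHAR: "CHAR('k alg_closure) = p" by simp
  have N: "N = p ^ (e * \<nu>)" by (simp add: N_def assms(2) power_mult)
  have "CARD('k) \<ge> 2" using card_mono[of "UNIV :: 'k set" "{0, 1}"] by simp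
  then have "N \<ge> 2" unfolding N_def using assms(3)
    by (meson le_trans self_le_power one_le_numeral)
  have of_nat_N: "of_nat N = (0 :: 'k alg_closure)"
    using \<open>N \<ge> 2\<close> unfolding of_nat_eq_0_iff_char_dvd CHAR N by (cases "e * \<nu>") auto
  have add: "(x + y) ^ N = x ^ N + y ^ N" for x y :: "'k alg_closure"
    using freshmans_dream'[where 'a = "'k alg_closure" and n = "e * \<nu>"] assms(1) CHAR N by simp
  have minus_N: "(- x) ^ N = - (x ^ N)" for x :: "'k alg_closure"
    using add[of x "- x"] \<open>N \<ge> 2\<close> by (simp add: eq_neg_iff_add_eq_0 add.commute power_0_left)
  let ?F = "{x :: 'k alg_closure. x ^ N = x}"
  have subfield: "subfield ?F R"
    using \<open>N \<ge> 2\<close>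
    by (intro R.subfieldI' R.subringI)
       (auto simp: minus_N add power_mult_distrib power_inverse)
  define P :: "'k alg_closure poly" where "P = monom 1 N - monom 1 1"
  have P: "degree P = N" "P \<noteq> 0"
  proof -
    have "degree (- monom 1 1 :: 'k alg_closure poly) < degree (monom 1 N :: 'k alg_closure poly)"
      using \<open>N \<ge> 2\<close> by (simp add: degree_monom_eq)
    from degree_add_eq_left[OF this] show "degree P = N"
      by (simp add: P_def degree_monom_eq)
    then show "P \<noteq> 0" using \<open>N \<ge> 2\<close> by auto
  qed
  have roots: "{x. poly P x = 0} = ?F" by (auto simp: P_def poly_monom)
  have fin: "finite ?F" using poly_roots_finite[OF P(2)] roots by simp
  have "pderiv P = -1"
    by (simp add: P_def pderiv_diff pderiv_monom of_nat_N monom_0 one_pCons)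
  then have pderiv: "poly (pderiv P) a = -1" for a by simp
  have "order a P < 2" for a
  proof (rule ccontr)
    assume "\<not> order a P < 2"
    then have "[:-a, 1:] ^ 2 dvd P"
      using P(2) by (simp add: order_divides)
    then obtain Q where "P = [:-a, 1:] * ([:-a, 1:] * Q)"
      by (metis dvdE power2_eq_square mult.assoc)
    then have "poly (pderiv P) a = 0"
      by (simp add: pderiv_mult del: mult_pCons_left)
    then show False using pderiv[of a] by simp
  qed
  then have "rsquarefree P" using P(2) by (auto simp: rsquarefree_def less_2_cases_iff)
  obtain A where A: "size A = degree P" "P = smult (lead_coeff P) (\<Prod>x\<in>#A. [:-x, 1:])"
    using alg_closed_imp_factorization[OF P(2)] by blast
  have prod: "(\<Prod>x\<in>#B. [:-x, 1:]) \<noteq> 0 \<and> proots (\<Prod>x\<in>#B. [:-x, 1:]) = B"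
    for B :: "'k alg_closure multiset"
  proof (induction B)
    case (add x B)
    then show ?case
      by (simp add: proots_mult del: mult_pCons_left)
  qed simp
  have proots: "proots P = A"
    using prod[of A] P(2) by (subst A(2)) simp
  have "count A x = 1" if "x \<in> set_mset A" for x
    using that \<open>rsquarefree P\<close> P(2) unfolding proots[symmetric] rsquarefree_def
    by (auto simp: order_root) (metis not_gr_zero)
  then have "size A = card (set_mset A)" by (simp add: size_multiset_overloaded_eq)
  also have "set_mset A = ?F" using proots P(2) roots by (metis set_count_proots)
  finally have card: "card ?F = N" using A(1) P(1) by simp
  have unique: "K = ?F" if "subfield K R" "card K = N" for K
  proof -
    have fin_K: "finite K" using that(2) \<open>N \<ge> 2\<close> by (intro card_ge_0_finite) simp
    have K0: "0 \<in> K"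
      using subringE(2)[OF subfieldE(1)[OF that(1)]] by simp
    have K_mult: "x * y \<in> K" if "x \<in> K" "y \<in> K" for x y
      using subringE(6)[OF subfieldE(1)[OF \<open>subfield K R\<close>] that] by simp
    have K_inverse: "inverse x \<in> K" if "x \<in> K" "x \<noteq> 0" for x
      using R.subfield_m_inv(1)[OF \<open>subfield K R\<close>, of x] that by simp
    have "x ^ N = x" if "x \<in> K" for x
    proof (cases "x = 0")
      case False
      have "(\<Prod>y\<in>K-{0}. x * y) = \<Prod>(K-{0})"
        by (rule prod.reindex_bij_witness[of _ "\<lambda>y. inverse x * y" "\<lambda>y. x * y"])
           (use False that K_mult K_inverse in simp_all)
      moreover have "(\<Prod>y\<in>K-{0}. x * y) = x ^ (N - 1) * \<Prod>(K-{0})"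
        using \<open>card K = N\<close> K0 fin_K by (simp add: prod.distrib card_Diff_singleton)
      moreover have "\<Prod>(K-{0}) \<noteq> 0" using fin_K by simp
      ultimately have "x ^ (N - 1) = 1" by simp
      then have "x * x ^ (N - 1) = x" by simp
      then show ?thesis using \<open>N \<ge> 2\<close> by (simp flip: power_Suc)
    qed (use \<open>N \<ge> 2\<close> in auto)
    then show ?thesis using card that(2) fin by (intro card_subset_eq) auto
  qed
  show eq: "Fq_ext \<nu> = ?F"
    unfolding Fq_ext_def R_def[symmetric] N_def[symmetric]
  proof (rule the_equality)
    show "subfield ?F R \<and> card ?F = N" using subfield card by blast
    show "K = ?F" if "subfield K R \<and> card K = N" for K using unique that by blast
  qed
  show "subfield (Fq_ext \<nu> :: 'k alg_closure set) ring_of_type_algebra"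
    "card (Fq_ext \<nu> :: 'k alg_closure set) = N"
    unfolding eq using subfield card unfolding R_def by blast+
qed

definition smult_matrix :: "'a::times \<Rightarrow> 'a ^ 'n ^ 'n \<Rightarrow> 'a ^ 'n ^ 'n" where
  "smult_matrix c A = (\<chi> i j. c * A $ i $ j)"

definition lincomb :: "(nat \<Rightarrow> 'a::semiring_1) \<Rightarrow> ('a ^ 'n ^ 'n) list \<Rightarrow> 'a ^ 'n ^ 'n" where
  "lincomb c Bs = (\<Sum>l<length Bs. smult_matrix (c l) (Bs ! l))"

definition span_over :: "'a::semiring_1 set \<Rightarrow> ('a ^ 'n ^ 'n) set \<Rightarrow> ('a ^ 'n ^ 'n) set" where
  "span_over K B = {A. \<exists>c Bs. set Bs \<subseteq> B \<and> (\<forall>l<length Bs. c l \<in> K) \<and> A = lincomb c Bs}"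

definition is_basis_over ::
    "'a::semiring_1 set \<Rightarrow> ('a ^ 'n ^ 'n) list \<Rightarrow> ('a ^ 'n ^ 'n) set \<Rightarrow> bool" where
  "is_basis_over K Bs V \<longleftrightarrow> span_over K (set Bs) = V \<and>
     (\<forall>c. (\<forall>l<length Bs. c l \<in> K) \<longrightarrow> lincomb c Bs = 0 \<longrightarrow> (\<forall>l<length Bs. c l = 0))"

definition word_val :: "('a::semiring_1 ^ 'n ^ 'n) list \<Rightarrow> 'a ^ 'n ^ 'n" where
  "word_val w = foldr (**) w (mat 1)"

definition word_at ::
    "('m \<Rightarrow> 'k alg_closure) \<Rightarrow> (('m::{finite,linorder}, 'k::field) ratfun ^ 'n ^ 'n) list
      \<Rightarrow> 'k alg_closure ^ 'n ^ 'n" where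
  "word_at \<alpha> w = word_val (map (\<lambda>T. mat_at T \<alpha>) w)"

text \<open>
  The procedure is a nondeterministic transition system, the order in which matrices are adjoined
  being left open. The basis under construction is kept as a list of words in \<open>\<T>\<close>, from which
  both $A_k$ and $A_k(\alpha)$ are computed.
\<close>

datatype 'a state = Start | Adjoining "'a list list" | Checking "'a list list" | Returned bool

inductive step ::
    "'k alg_closure set \<Rightarrow> ('m \<Rightarrow> 'k alg_closure) \<Rightarrow>
     (('m::{finite,linorder}, 'k::field) ratfun ^ 'n ^ 'n) set \<Rightarrow>
     (('m, 'k) ratfun ^ 'n ^ 'n) state \<Rightarrow> (('m, 'k) ratfun ^ 'n ^ 'n) state \<Rightarrow> bool"
  for K \<alpha> \<T> where
  not_distinct:
    "\<not> inj_on (\<lambda>T. mat_at T \<alpha>) \<T> \<Longrightarrow> step K \<alpha> \<T> Start (Returned False)"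
| distinct:
    "inj_on (\<lambda>T. mat_at T \<alpha>) \<T> \<Longrightarrow> step K \<alpha> \<T> Start (Adjoining [[]])"
| adjoin:
    "w \<in> set ws \<Longrightarrow> T \<in> \<T> \<Longrightarrow>
     word_at \<alpha> w ** mat_at T \<alpha> \<notin> span_over K (word_at \<alpha> ` set ws) \<Longrightarrow>
     step K \<alpha> \<T> (Adjoining ws) (Adjoining (ws @ [w @ [T]]))"
| adjoining_done:
    "\<forall>w\<in>set ws. \<forall>T\<in>\<T>. word_at \<alpha> w ** mat_at T \<alpha> \<in> span_over K (word_at \<alpha> ` set ws) \<Longrightarrow>
     step K \<alpha> \<T> (Adjoining ws) (Checking ws)"
| relation_fails:
    "k < length ws \<Longrightarrow> T \<in> \<T> \<Longrightarrow> \<forall>l<length ws. a l \<in> K \<Longrightarrow>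
     word_at \<alpha> (ws ! k) ** mat_at T \<alpha> = lincomb a (map (word_at \<alpha>) ws) \<Longrightarrow>
     mat_to_ac (word_val (ws ! k) ** T)
       \<noteq> lincomb (\<lambda>l. const_ratfun (a l)) (map (\<lambda>w. mat_to_ac (word_val w)) ws) \<Longrightarrow>
     step K \<alpha> \<T> (Checking ws) (Returned False)"
| relations_hold:
    "\<forall>k<length ws. \<forall>T\<in>\<T>. \<exists>a. (\<forall>l<length ws. a l \<in> K) \<and>
       word_at \<alpha> (ws ! k) ** mat_at T \<alpha> = lincomb a (map (word_at \<alpha>) ws) \<and>
       mat_to_ac (word_val (ws ! k) ** T)
         = lincomb (\<lambda>l. const_ratfun (a l)) (map (\<lambda>w. mat_to_ac (word_val w)) ws) \<Longrightarrow>
     step K \<alpha> \<T> (Checking ws) (Returned True)"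

text \<open>Every run terminates, and does so by returning \<open>b\<close>.\<close>

definition procedure_returns ::
    "'k alg_closure set \<Rightarrow> ('m \<Rightarrow> 'k alg_closure) \<Rightarrow>
     (('m::{finite,linorder}, 'k::field) ratfun ^ 'n ^ 'n) set \<Rightarrow> bool \<Rightarrow> bool" where
  "procedure_returns K \<alpha> \<T> b \<longleftrightarrow>
     \<not> (\<exists>\<sigma>. \<sigma> 0 = Start \<and> (\<forall>i. step K \<alpha> \<T> (\<sigma> i) (\<sigma> (Suc i)))) \<and>
     (\<forall>s. (step K \<alpha> \<T>)\<^sup>*\<^sup>* Start s \<longrightarrow> (\<nexists>s'. step K \<alpha> \<T> s s') \<longrightarrow> s = Returned b)"

end

theory Submission
  imports Defs "HOL-Analysis.Determinants" "HOL-Algebra.Sylow"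
begin

text \<open>
  Write \<open>H\<close> for the group generated by \<open>S'\<close>. The procedure tests whether substitution at \<open>\<alpha>\<close> identifies
  the enveloping algebra of \<open>H\<close> over \<open>K = Fq_ext \<nu>\<close> with that of its image. Three facts carry the proof.

  Firstly, in a nilpotent group generated by elements \<open>s\<close> with \<open>s\<^sup>b = 1\<close>, every element is killed by a
  power of \<open>b\<close>, and the group is finite if it is finitely generated (\<open>nilpotent_torsion_generated\<close>):
  the factors of the lower central series are abelian of exponent \<open>b\<close>. Hence \<open>G\<close> is finite if and only
  if \<open>H\<close> is. Moreover, an element of finite order in \<open>GL(n)\<close> has \<open>p\<^sup>\<gamma>\<close>-th power of order prime to \<open>p\<close>
  (\<open>prime_power_kills_p_part\<close>), so for finite \<open>G\<close> the order of \<open>H\<close> is prime to \<open>p\<close>.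

  Secondly, if \<open>H\<close> is finite of order prime to \<open>p\<close>, substitution is injective on its enveloping algebra
  (\<open>maschke_inj\<close>): by an averaging argument the kernel is generated by an idempotent matrix, which
  reduces to \<open>0\<close> and therefore is \<open>0\<close>. So every relation found at \<open>\<alpha>\<close> is a relation between the
  matrices themselves, and the procedure cannot return \<open>false\<close> (\<open>not_returned_false\<close>).

  Thirdly, if the relations hold, the \<open>K\<close>-span of the \<open>A\<^sub>k\<close> is a finite set that is closed under
  multiplication by \<open>S'\<close>, and \<open>H\<close> is finite (\<open>returned_true_finite\<close>); so for infinite \<open>G\<close> the
  procedure cannot return \<open>true\<close>. It always terminates, since the values at \<open>\<alpha>\<close> are matrices over the
  finite field \<open>K\<close> (\<open>procedure_returnsI\<close>).
\<close>

section \<open>Nilpotent groups generated by elements of finite order\<close>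

text \<open>
  Unfolded, a term of the lower central series is a generated subgroup of nested unions; the
  arguments below use it only through containment of commutators, so it is kept folded.
\<close>

declare lower_central.simps(2) [simp del]

abbreviation (in group) comm :: "'a \<Rightarrow> 'a \<Rightarrow> 'a" where
  "comm x y \<equiv> x \<otimes> y \<otimes> inv x \<otimes> inv y"

lemma (in group) subgroup_lower_central: "subgroup (lower_central G i) G"
proof (induction i)
  case 0
  show ?case by (simp add: subgroup_self)
next
  case (Suc i)
  then have "lower_central G i \<subseteq> carrier G" by (simp add: subgroup.subset)
  then show ?case unfolding lower_central.simps
    by (intro generate_is_subgroup) (auto intro!: m_closed inv_closed)
qed

lemma (in group) lower_central_carrier: "x \<in> lower_central G i \<Longrightarrow> x \<in> carrier G"
  using subgroup_lower_central subgroup.subset by blast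

lemma (in group) comm_in_lower_central:
  "x \<in> lower_central G i \<Longrightarrow> y \<in> carrier G \<Longrightarrow> comm x y \<in> lower_central G (Suc i)"
  by (auto intro!: generate.incl simp: lower_central.simps(2))

text \<open>
  The conjugate \<open>y x y\<inverse>\<close> equals \<open>[x,y]\<inverse> x\<close>, so a subgroup that contains its commutators with the
  whole group is normal. This gives the normality of the lower central series and of every subgroup
  between two consecutive terms of it.
\<close>

lemma (in group) normal_between:
  assumes D: "subgroup D G" and N: "N \<subseteq> D"
    and comm: "\<And>x y. x \<in> D \<Longrightarrow> y \<in> carrier G \<Longrightarrow> comm x y \<in> N"
  shows "D \<lhd> G"
proof (rule normal_invI[OF D])
  fix y x assume xy: "y \<in> carrier G" "x \<in> D"
  have c: "x \<in> carrier G" using xy D subgroup.subset by blast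
  have "inv (comm x y) \<otimes> x \<in> D"
    using comm[OF xy(2,1)] N xy D by (meson subgroup.m_closed subgroup.m_inv_closed subsetD)
  also have "inv (comm x y) \<otimes> x = y \<otimes> x \<otimes> inv y"
    using xy(1) c by (simp add: inv_mult_group m_assoc)
  finally show "y \<otimes> x \<otimes> inv y \<in> D" .
qed

lemma (in group) lower_central_antimono: "lower_central G (Suc i) \<subseteq> lower_central G i"
proof (induction i)
  case 0
  have "subgroup (lower_central G (Suc 0)) G" by (rule subgroup_lower_central)
  then show ?case using subgroup.subset by force
next
  case (Suc i)
  then show ?case
    by (subst (1 2) lower_central.simps) (intro mono_generate; blast)
qed

lemma (in group) normal_lower_central: "lower_central G i \<lhd> G"
  using subgroup_lower_central lower_central_antimono comm_in_lower_central
  by (rule normal_between)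

lemma (in group) inv_cancel_left:
  assumes "x \<in> carrier G" "y \<in> carrier G"
  shows "x \<otimes> (inv x \<otimes> y) = y" "inv x \<otimes> (x \<otimes> y) = y"
  using assms by (simp_all flip: m_assoc)

lemma (in group) comm_mult_left:
  assumes "x \<in> carrier G" "x' \<in> carrier G" "y \<in> carrier G"
  shows "comm (x \<otimes> x') y = (x \<otimes> comm x' y \<otimes> inv x) \<otimes> comm x y"
  using assms by (simp add: inv_mult_group m_assoc inv_cancel_left)

lemma (in group) comm_mult_right:
  assumes "x \<in> carrier G" "y' \<in> carrier G" "y \<in> carrier G"
  shows "comm x (y \<otimes> y') = comm x y \<otimes> (y \<otimes> comm x y' \<otimes> inv y)"
  using assms by (simp add: inv_mult_group m_assoc inv_cancel_left)

lemma (in group) comm_inv_left: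
  assumes "x \<in> carrier G" "y \<in> carrier G"
  shows "comm (inv x) y = inv x \<otimes> inv (comm x y) \<otimes> inv (inv x)"
  using assms by (simp add: inv_mult_group m_assoc)

lemma (in group) comm_inv_right:
  assumes "x \<in> carrier G" "y \<in> carrier G"
  shows "comm x (inv y) = inv y \<otimes> inv (comm x y) \<otimes> inv (inv y)"
  using assms by (simp add: inv_mult_group m_assoc inv_cancel_left)

text \<open>
  Membership of commutators in a normal subgroup is preserved by products and inverses in either
  argument, so it need only be checked on generators. This replaces bilinearity of the commutator.
\<close>

lemma (in group) subgroup_comm_left:
  assumes D: "D \<lhd> G" and y: "y \<in> carrier G"
  shows "subgroup {x \<in> carrier G. comm x y \<in> D} G"
proof -
  interpret D: normal D G by fact
  show ?thesis
  proof (rule subgroupI)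
    show "{x \<in> carrier G. comm x y \<in> D} \<noteq> {}"
      using y D.one_closed by (auto intro!: exI[of _ \<one>])
  next
    fix x assume "x \<in> {x \<in> carrier G. comm x y \<in> D}"
    then have x: "x \<in> carrier G" "comm x y \<in> D" by auto
    have "comm (inv x) y \<in> D"
      unfolding comm_inv_left[OF x(1) y] using x by (intro D.inv_op_closed2) auto
    then show "inv x \<in> {x \<in> carrier G. comm x y \<in> D}" using x by simp
  next
    fix x x' assume "x \<in> {x \<in> carrier G. comm x y \<in> D}" "x' \<in> {x \<in> carrier G. comm x y \<in> D}"
    then show "x \<otimes> x' \<in> {x \<in> carrier G. comm x y \<in> D}"
      using y D.inv_op_closed2[of "x" "comm x' y"]
      by (simp add: comm_mult_left[of x x' y] D.m_closed)
  qed auto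
qed

lemma (in group) subgroup_comm_right:
  assumes D: "D \<lhd> G" and x: "x \<in> carrier G"
  shows "subgroup {y \<in> carrier G. comm x y \<in> D} G"
proof -
  interpret D: normal D G by fact
  show ?thesis
  proof (rule subgroupI)
    show "{y \<in> carrier G. comm x y \<in> D} \<noteq> {}"
      using x D.one_closed by (auto intro!: exI[of _ \<one>])
  next
    fix y assume "y \<in> {y \<in> carrier G. comm x y \<in> D}"
    then have y: "y \<in> carrier G" "comm x y \<in> D" by auto
    have "comm x (inv y) \<in> D"
      unfolding comm_inv_right[OF x y(1)] using y by (intro D.inv_op_closed2) auto
    then show "inv y \<in> {y \<in> carrier G. comm x y \<in> D}" using y by simp
  next
    fix y y' assume "y \<in> {y \<in> carrier G. comm x y \<in> D}" "y' \<in> {y \<in> carrier G. comm x y \<in> D}"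
    then show "y \<otimes> y' \<in> {y \<in> carrier G. comm x y \<in> D}"
      using x D.inv_op_closed2[of "y" "comm x y'"]
      by (simp add: comm_mult_right[of x y' y] D.m_closed)
  qed auto
qed

text \<open>
  If \<open>B\<close> generates \<open>\<Gamma>\<^sub>i\<close> modulo \<open>\<Gamma>\<^sub>i\<^sub>+\<^sub>1\<close>, then the commutators of elements of \<open>B\<close> with generators of
  the group generate \<open>\<Gamma>\<^sub>i\<^sub>+\<^sub>1\<close> modulo \<open>\<Gamma>\<^sub>i\<^sub>+\<^sub>2\<close>. Hence all factors of the lower central series of a finitely
  generated group are finitely generated.
\<close>

lemma (in group) lower_central_generated:
  assumes S: "S \<subseteq> carrier G" "carrier G = generate G S" "finite S"
  shows "\<exists>B. finite B \<and> B \<subseteq> lower_central G i \<and>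
           lower_central G i = generate G (B \<union> lower_central G (Suc i))"
proof (induction i)
  case 0
  have "generate G S \<subseteq> generate G (S \<union> lower_central G (Suc 0))" by (intro mono_generate) auto
  moreover have "generate G (S \<union> lower_central G (Suc 0)) \<subseteq> carrier G"
    using S(1) lower_central_carrier by (intro generate_incl) blast
  ultimately have "lower_central G 0 = generate G (S \<union> lower_central G (Suc 0))"
    using S(2) by simp
  then show ?case using S by (intro exI[of _ S]) simp
next
  case (Suc i)
  then obtain B where B: "finite B" "B \<subseteq> lower_central G i"
    "lower_central G i = generate G (B \<union> lower_central G (Suc i))" by blast
  define B' where "B' = (\<Union>x\<in>B. \<Union>s\<in>S. {comm x s})"
  let ?D = "generate G (B' \<union> lower_central G (Suc (Suc i)))"
  have B': "finite B'" "B' \<subseteq> lower_central G (Suc i)"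
    using B(1,2) S(1,3) comm_in_lower_central by (auto 0 3 simp: B'_def)
  have D_incl: "?D \<subseteq> lower_central G (Suc i)"
    using B'(2) lower_central_antimono subgroup_lower_central
    by (intro generate_subgroup_incl) auto
  have D: "?D \<lhd> G"
  proof (rule normal_between)
    show "subgroup ?D G" using B'(2) lower_central_carrier
      by (intro generate_is_subgroup) auto
    show "lower_central G (Suc (Suc i)) \<subseteq> ?D"
      by (auto intro: generate.incl)
    show "comm x y \<in> lower_central G (Suc (Suc i))" if "x \<in> ?D" "y \<in> carrier G" for x y
      using that D_incl comm_in_lower_central by blast
  qed
  have *: "lower_central G i \<subseteq> {x \<in> carrier G. comm x s \<in> ?D}" if s: "s \<in> S" for s
  proof -
    have "B \<union> lower_central G (Suc i) \<subseteq> {x \<in> carrier G. comm x s \<in> ?D}"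
    proof
      fix x assume x: "x \<in> B \<union> lower_central G (Suc i)"
      then have "x \<in> carrier G" using B(2) lower_central_carrier by blast
      moreover have "comm x s \<in> B' \<union> lower_central G (Suc (Suc i))"
        using x s S(1) comm_in_lower_central[of x "Suc i" s] unfolding B'_def by blast
      ultimately show "x \<in> {x \<in> carrier G. comm x s \<in> ?D}" by (auto intro: generate.incl)
    qed
    then show ?thesis unfolding B(3)
      using subgroup_comm_left[OF D] s S(1) by (intro generate_subgroup_incl) auto
  qed
  have "comm x y \<in> ?D" if x: "x \<in> lower_central G i" and y: "y \<in> carrier G" for x y
  proof -
    have "S \<subseteq> {y \<in> carrier G. comm x y \<in> ?D}" using * x S(1) by blast
    then have "generate G S \<subseteq> {y \<in> carrier G. comm x y \<in> ?D}"
      using subgroup_comm_right[OF D] x lower_central_carrier by (intro generate_subgroup_incl) auto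
    then show ?thesis using y S(2) by blast
  qed
  then have "lower_central G (Suc i) \<subseteq> ?D"
    unfolding lower_central.simps(2)[of G i] using normal_imp_subgroup[OF D]
    by (intro generate_subgroup_incl) blast+
  then show ?case using B' D_incl by (intro exI[of _ B']) blast
qed

lemma (in group) comm_eq_one_iff:
  assumes "x \<in> carrier G" "y \<in> carrier G"
  shows "comm x y = \<one> \<longleftrightarrow> x \<otimes> y = y \<otimes> x"
proof -
  have "comm x y = (x \<otimes> y) \<otimes> inv (y \<otimes> x)"
    using assms by (simp add: inv_mult_group m_assoc)
  then show ?thesis using assms inv_solve_right'[of \<one> "x \<otimes> y" "y \<otimes> x"] by auto
qed

lemma (in group) comm_pow_left:
  assumes x: "x \<in> carrier G" and y: "y \<in> carrier G"
    and c: "x \<otimes> comm x y = comm x y \<otimes> x"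
  shows "comm (x [^] (k::nat)) y = comm x y [^] k"
proof (induction k)
  case (Suc k)
  have "x \<otimes> comm x y [^] k = comm x y [^] k \<otimes> x"
    using group_commutes_pow[OF c[symmetric]] x y by simp
  then have *: "x \<otimes> comm x y [^] k \<otimes> inv x = comm x y [^] k"
    using x y by (simp add: m_assoc)
  have "x [^] Suc k = x \<otimes> x [^] k" using x by (rule nat_pow_Suc2)
  then have "comm (x [^] Suc k) y = (x \<otimes> comm (x [^] k) y \<otimes> inv x) \<otimes> comm x y"
    using x y by (simp add: comm_mult_left)
  also have "\<dots> = comm x y [^] Suc k" unfolding Suc * by simp
  finally show ?case .
qed (use x y in simp)

text \<open>
  Right multiplication by a generator maps the finite set \<open>C\<close> injectively into itself, hence onto
  itself; so closure under the generators already gives closure under their inverses. This is what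
  connects the words of the procedure, which have no inverses, with the generated group.
\<close>

lemma (in group) finite_generate_closed:
  assumes C: "finite C" "C \<subseteq> carrier G" "\<one> \<in> C"
    and A: "A \<subseteq> carrier G" "\<And>a c. a \<in> A \<Longrightarrow> c \<in> C \<Longrightarrow> c \<otimes> a \<in> C"
  shows "generate G A \<subseteq> C"
proof -
  have "\<forall>c\<in>C. c \<otimes> x \<in> C" if "x \<in> generate G A" for x using that
  proof (induction rule: generate.induct)
    case (inv h)
    have h: "h \<in> carrier G" using inv A by auto
    have "inj_on (\<lambda>c. c \<otimes> h) C" using C(2) h by (auto intro!: inj_onI) (metis r_cancel subsetD)
    moreover have "(\<lambda>c. c \<otimes> h) ` C \<subseteq> C" using inv A by auto
    ultimately have *: "(\<lambda>c. c \<otimes> h) ` C = C" using C(1) endo_inj_surj by blast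
    show ?case
    proof
      fix c assume "c \<in> C"
      then obtain d where "d \<in> C" "c = d \<otimes> h" using * by auto
      then show "c \<otimes> inv h \<in> C" using C h by (auto simp: m_assoc)
    qed
  next
    case (eng g h)
    then have "g \<in> carrier G" "h \<in> carrier G" using A generate_in_carrier by auto
    then show ?case using eng C by (auto simp flip: m_assoc)
  qed (use A C in auto)
  then show ?thesis using C(3) A(1) generate_in_carrier by (metis l_one subsetI)
qed

text \<open>
  The generated group is the union of the cosets \<open>N x\<^sup>j\<close> with \<open>j < b\<close>.
\<close>

lemma (in group) finite_generate_insert:
  assumes N: "subgroup N G" "finite N" and x: "x \<in> carrier G" "x [^] (b::nat) \<in> N" "b > 0"
    and norm: "\<And>y. y \<in> N \<Longrightarrow> x \<otimes> y \<otimes> inv x \<in> N"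
  shows "finite (generate G (insert x N))"
proof -
  interpret N: subgroup N G by fact
  define C where "C = (\<Union>j<b. (\<lambda>y. y \<otimes> x [^] j) ` N)"
  have norm_pow: "x [^] j \<otimes> y \<otimes> inv (x [^] j) \<in> N" if "y \<in> N" for y and j :: nat
  proof (induction j)
    case (Suc j)
    have "x [^] Suc j \<otimes> y \<otimes> inv (x [^] Suc j) = x \<otimes> (x [^] j \<otimes> y \<otimes> inv (x [^] j)) \<otimes> inv x"
      unfolding nat_pow_Suc2[OF x(1)] using x that by (simp add: inv_mult_group m_assoc)
    then show ?case using norm[OF Suc] by simp
  qed (use that in simp)
  have "generate G (insert x N) \<subseteq> C"
  proof (rule finite_generate_closed)
    show "finite C" using N by (simp add: C_def)
    show "C \<subseteq> carrier G" using x by (auto simp: C_def)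
    show "\<one> \<in> C" using \<open>b > 0\<close> N.one_closed unfolding C_def
      by (intro UN_I[of 0]) (auto intro!: image_eqI[of _ _ \<one>])
    show "insert x N \<subseteq> carrier G" using x by auto
    fix a c assume "a \<in> insert x N" "c \<in> C"
    then obtain j y where jy: "j < b" "y \<in> N" "c = y \<otimes> x [^] j" by (auto simp: C_def)
    from \<open>a \<in> insert x N\<close> show "c \<otimes> a \<in> C"
    proof
      assume "a = x"
      then have ca: "c \<otimes> a = y \<otimes> x [^] Suc j" using jy x by (simp add: m_assoc)
      show ?thesis
      proof (cases "Suc j = b")
        case True
        then have "c \<otimes> a \<in> N" unfolding ca using x jy N.m_closed by simp
        then show ?thesis using \<open>b > 0\<close> x unfolding C_def
          by (intro UN_I[of 0]) (auto intro!: image_eqI[of _ _ "c \<otimes> a"])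
      next
        case False
        then show ?thesis using jy(1,2) unfolding C_def ca by (intro UN_I[of "Suc j"]) auto
      qed
    next
      assume a: "a \<in> N"
      have "c \<otimes> a = (y \<otimes> (x [^] j \<otimes> a \<otimes> inv (x [^] j))) \<otimes> x [^] j"
        using a jy x by (simp add: m_assoc)
      moreover have "y \<otimes> (x [^] j \<otimes> a \<otimes> inv (x [^] j)) \<in> N"
        using jy(2) norm_pow[OF a] by (rule N.m_closed)
      ultimately show ?thesis using jy(1) unfolding C_def by blast
    qed
  qed
  moreover have "finite C" using N by (simp add: C_def)
  ultimately show ?thesis by (rule finite_subset)
qed

lemma (in group_hom) hom_comm:
  "x \<in> carrier G \<Longrightarrow> y \<in> carrier G \<Longrightarrow> h (G.comm x y) = H.comm (h x) (h y)"
  by simp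

lemma (in normal) rcos_eq_one_iff:
  "a \<in> carrier G \<Longrightarrow> H #> a = \<one>\<^bsub>G Mod H\<^esub> \<longleftrightarrow> a \<in> H"
  using coset_join1[of H a] coset_join2[of a H] subset is_subgroup by (auto simp: FactGroup_def)

lemma (in normal) group_hom_Mod: "group_hom G (G Mod H) ((#>) H)"
  by (intro group_hom.intro group_hom_axioms.intro is_group factorgroup_is_group r_coset_hom_Mod)

text \<open>
  Modulo \<open>H\<close> the subgroup generated by \<open>A\<close> is abelian, so taking \<open>b\<close>-th powers is a homomorphism
  there, and it is trivial as soon as it is trivial on \<open>A\<close>.
\<close>

lemma (in normal) pow_in_subgroup:
  assumes A: "A \<subseteq> carrier G" "\<And>a. a \<in> A \<Longrightarrow> a [^] (b::nat) \<in> H"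
    and comm: "\<And>x y. x \<in> generate G A \<Longrightarrow> y \<in> generate G A \<Longrightarrow> x \<otimes> y \<otimes> inv x \<otimes> inv y \<in> H"
    and x: "x \<in> generate G A"
  shows "x [^] b \<in> H"
proof -
  interpret \<pi>: group_hom G "G Mod H" "(#>) H" by (rule group_hom_Mod)
  have "(H #> x) [^]\<^bsub>G Mod H\<^esub> b = \<one>\<^bsub>G Mod H\<^esub>" using x
  proof (induction rule: generate.induct)
    case one
    show ?case unfolding \<pi>.hom_one by (rule \<pi>.H.nat_pow_one)
  next
    case (incl h)
    then show ?case using A rcos_eq_one_iff[of "h [^] b"] \<pi>.hom_nat_pow[of h b] by auto
  next
    case (inv h)
    then have h: "h \<in> carrier G" "h [^] b \<in> H" using A by auto
    then have "inv h [^] b \<in> H" by (simp add: nat_pow_inv)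
    then show ?case using h rcos_eq_one_iff[of "inv h [^] b"] \<pi>.hom_nat_pow[of "inv h" b] by auto
  next
    case (eng g h)
    have c: "g \<in> carrier G" "h \<in> carrier G" using eng A(1) generate_in_carrier by auto
    then have c': "H #> g \<in> carrier (G Mod H)" "H #> h \<in> carrier (G Mod H)"
      using \<pi>.hom_closed by blast+
    have "H #> comm g h = \<one>\<^bsub>G Mod H\<^esub>"
      by (rule iffD2[OF rcos_eq_one_iff comm[OF eng(1,2)]]) (use c in simp)
    then have "(H #> g) \<otimes>\<^bsub>G Mod H\<^esub> (H #> h) = (H #> h) \<otimes>\<^bsub>G Mod H\<^esub> (H #> g)"
      unfolding \<pi>.hom_comm[OF c] \<pi>.H.comm_eq_one_iff[OF c'] .
    then have "((H #> g) \<otimes>\<^bsub>G Mod H\<^esub> (H #> h)) [^]\<^bsub>G Mod H\<^esub> b = \<one>\<^bsub>G Mod H\<^esub>"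
      using eng.IH c' by (simp only: \<pi>.H.pow_mult_distrib \<pi>.H.r_one \<pi>.H.one_closed)
    then show ?case unfolding \<pi>.hom_mult[OF c] .
  qed
  moreover have "x \<in> carrier G" using x A(1) generate_in_carrier by blast
  ultimately show ?thesis using rcos_eq_one_iff[of "x [^] b"] \<pi>.hom_nat_pow[of x b]
    by auto
qed

text \<open>
  The exponent \<open>b\<close> passes down the lower central series because \<open>[u,y]\<^sup>b \<equiv> [u\<^sup>b,y]\<close> modulo \<open>\<Gamma>\<^sub>i\<^sub>+\<^sub>2\<close> for
  \<open>u\<close> in \<open>\<Gamma>\<^sub>i\<close>, and \<open>u\<^sup>b\<close> lies in \<open>\<Gamma>\<^sub>i\<^sub>+\<^sub>1\<close> by induction.
\<close>

lemma (in group) lower_central_pow: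
  assumes S: "S \<subseteq> carrier G" "carrier G = generate G S"
    and b: "\<And>s. s \<in> S \<Longrightarrow> s [^] (b::nat) = \<one>"
  shows "x \<in> lower_central G i \<Longrightarrow> x [^] b \<in> lower_central G (Suc i)"
proof (induction i arbitrary: x)
  case 0
  interpret N: normal "lower_central G (Suc 0)" G by (rule normal_lower_central)
  show ?case
  proof (rule N.pow_in_subgroup[OF S(1)])
    show "a [^] b \<in> lower_central G (Suc 0)" if "a \<in> S" for a
      using b[OF that] N.one_closed by simp
    show "comm x y \<in> lower_central G (Suc 0)" if "x \<in> generate G S" "y \<in> generate G S" for x y
      using that S(2) comm_in_lower_central[of x 0 y] by simp
    show "x \<in> generate G S" using 0 S(2) by simp
  qed
next
  case (Suc i)
  let ?N = "lower_central G (Suc (Suc i))"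
  let ?A = "\<Union>x\<in>lower_central G i. \<Union>y\<in>carrier G. {comm x y}"
  interpret N: normal ?N G by (rule normal_lower_central)
  interpret \<pi>: group_hom G "G Mod ?N" "(#>) ?N" by (rule N.group_hom_Mod)
  show ?case
  proof (rule N.pow_in_subgroup)
    have gen: "generate G ?A = lower_central G (Suc i)" by (simp only: lower_central.simps)
    show "?A \<subseteq> carrier G"
      using subgroup.mem_carrier[OF subgroup_lower_central[of i]] by auto
    show "x \<in> generate G ?A" unfolding gen by (rule Suc.prems)
    show "comm y z \<in> ?N" if "y \<in> generate G ?A" "z \<in> generate G ?A" for y z
      using that unfolding gen by (rule comm_in_lower_central[OF _ lower_central_carrier])
    fix a assume "a \<in> ?A"
    then obtain u y where uy: "u \<in> lower_central G i" "y \<in> carrier G" "a = comm u y" by blast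
    have c: "u \<in> carrier G" "a \<in> carrier G" using lower_central_carrier[OF uy(1)] uy(2,3) by simp_all
    have c': "?N #> u \<in> carrier (G Mod ?N)" "?N #> a \<in> carrier (G Mod ?N)" "?N #> y \<in> carrier (G Mod ?N)"
      using c uy(2) \<pi>.hom_closed by blast+
    have "a \<in> lower_central G (Suc i)" using uy comm_in_lower_central by blast
    then have "comm a u \<in> ?N" using c comm_in_lower_central by blast
    then have "?N #> comm a u = \<one>\<^bsub>G Mod ?N\<^esub>"
      by (intro iffD2[OF N.rcos_eq_one_iff]) (use c in simp_all)
    then have com: "(?N #> u) \<otimes>\<^bsub>G Mod ?N\<^esub> (?N #> a) = (?N #> a) \<otimes>\<^bsub>G Mod ?N\<^esub> (?N #> u)"
      unfolding \<pi>.hom_comm[OF c(2,1)] \<pi>.H.comm_eq_one_iff[OF c'(2,1)] by (rule sym)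
    have a: "?N #> a = \<pi>.H.comm (?N #> u) (?N #> y)"
      unfolding uy(3) using c(1) uy(2) by (rule \<pi>.hom_comm)
    have "?N #> (a [^] b) = (?N #> a) [^]\<^bsub>G Mod ?N\<^esub> b"
      using c(2) by (rule \<pi>.hom_nat_pow)
    also have "\<dots> = \<pi>.H.comm ((?N #> u) [^]\<^bsub>G Mod ?N\<^esub> b) (?N #> y)"
      using com unfolding a by (rule \<pi>.H.comm_pow_left[OF c'(1,3), symmetric])
    also have "\<dots> = ?N #> comm (u [^] b) y"
      unfolding \<pi>.hom_nat_pow[OF c(1), symmetric]
      using c(1) uy(2) by (intro \<pi>.hom_comm[symmetric] nat_pow_closed)
    also have "\<dots> = \<one>\<^bsub>G Mod ?N\<^esub>"
      using c(1) uy(2)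
      by (intro iffD2[OF N.rcos_eq_one_iff comm_in_lower_central[OF Suc.IH[OF uy(1)] uy(2)]]) simp
    finally show "a [^] b \<in> ?N" unfolding N.rcos_eq_one_iff[OF nat_pow_closed[OF c(2)]] .
  qed
qed

text \<open>
  Every factor of the lower central series is abelian of exponent \<open>b\<close> and, for finite \<open>S\<close>, finitely
  generated, hence finite. The first part bounds the exponent of the whole group, which controls the
  primes dividing its order; the second part gives its finiteness.
\<close>

theorem (in group) nilpotent_torsion_generated:
  assumes nil: "nilpotent_group G"
    and S: "S \<subseteq> carrier G" "carrier G = generate G S"
    and b: "\<And>s. s \<in> S \<Longrightarrow> s [^] (b::nat) = \<one>"
  shows "\<exists>c. \<forall>x\<in>carrier G. x [^] (b ^ c) = \<one>"
    and "finite S \<Longrightarrow> b > 0 \<Longrightarrow> finite (carrier G)"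
proof -
  obtain c where c: "lower_central G c = {\<one>}" using nil by (auto simp: nilpotent_group_def)
  have "x [^] (b ^ i) \<in> lower_central G i" if "x \<in> carrier G" for x i
  proof (induction i)
    case (Suc i)
    have "x [^] (b ^ Suc i) = (x [^] (b ^ i)) [^] b"
      using that by (simp add: nat_pow_pow mult.commute)
    then show ?case using lower_central_pow[OF S b Suc] by simp
  qed (use that in simp)
  then show "\<exists>c. \<forall>x\<in>carrier G. x [^] (b ^ c) = \<one>" using c by blast
  assume "finite S" "b > 0"
  have "finite (lower_central G (c - i))" if "i \<le> c" for i using that
  proof (induction i)
    case (Suc i)
    define j where "j = c - Suc i"
    have j: "Suc j = c - i" using Suc.prems by (simp add: j_def)
    obtain B where B: "finite B" "B \<subseteq> lower_central G j"
      "lower_central G j = generate G (B \<union> lower_central G (Suc j))"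
      using lower_central_generated[OF S \<open>finite S\<close>] by blast
    have "finite (generate G (A \<union> lower_central G (Suc j)))" if "finite A" "A \<subseteq> lower_central G j" for A
      using that
    proof (induction A)
      case empty
      have "generate G (lower_central G (Suc j)) \<subseteq> lower_central G (Suc j)"
        by (intro generate_subgroup_incl subgroup_lower_central order_refl)
      moreover have "finite (lower_central G (Suc j))" using Suc j by simp
      ultimately have "finite (generate G (lower_central G (Suc j)))" by (rule finite_subset)
      then show ?case unfolding Un_empty_left .
    next
      case (insert x A)
      let ?N = "generate G (A \<union> lower_central G (Suc j))"
      have x: "x \<in> carrier G" using insert lower_central_carrier by blast
      have c: "A \<union> lower_central G (Suc j) \<subseteq> lower_central G j"
        using insert.prems lower_central_antimono by blast
      then have sub: "subgroup ?N G"
        using lower_central_carrier by (intro generate_is_subgroup) blast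
      interpret N: subgroup ?N G by fact
      have N_incl: "?N \<subseteq> lower_central G j" using c subgroup_lower_central by (intro generate_subgroup_incl)
      have *: "comm y x \<in> ?N" if "y \<in> ?N" for y
      proof (rule generate.incl)
        show "comm y x \<in> A \<union> lower_central G (Suc j)"
          using that comm_in_lower_central[of y j x] x N_incl by blast
      qed
      have "finite (generate G (insert x ?N))"
      proof (rule finite_generate_insert[OF sub])
        show "finite ?N" using insert by simp
        show "x [^] b \<in> ?N"
        proof (rule generate.incl)
          show "x [^] b \<in> A \<union> lower_central G (Suc j)"
            using lower_central_pow[OF S b, of x j] insert.prems by blast
        qed
        show "x \<otimes> y \<otimes> inv x \<in> ?N" if y: "y \<in> ?N" for y
        proof -
          have "x \<otimes> y \<otimes> inv x = inv (comm y x) \<otimes> y"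
            using x N.mem_carrier[OF y] by (simp add: inv_mult_group m_assoc)
          then show ?thesis using *[OF y] y by simp
        qed
      qed (use x \<open>b > 0\<close> in auto)
      moreover have "generate G (insert x A \<union> lower_central G (Suc j)) \<subseteq> generate G (insert x ?N)"
        by (intro mono_generate) (auto intro: generate.incl)
      ultimately show ?case by (rule finite_subset[rotated])
    qed
    from this[OF B(1,2)] show ?case using B(3) unfolding j_def by simp
  qed (use c in simp)
  from this[of c] show "finite (carrier G)" by simp
qed

lemma (in group) pow_card_subgroup:
  assumes "subgroup A G" "finite A" "x \<in> A"
  shows "x [^] card A = \<one>"
proof -
  interpret GA: group "G\<lparr>carrier := A\<rparr>" using assms(1) by (rule subgroup_imp_group)
  show ?thesis
    using GA.pow_order_eq_1[of x] assms by (simp add: Coset.order_def nat_pow_consistent[symmetric])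
qed

text \<open>
  A Sylow argument: a prime dividing the order gives a subgroup of that order, and every element of
  it is trivial, having order dividing both \<open>p\<close> and \<open>n\<close>.
\<close>

lemma (in group) prime_not_dvd_order:
  assumes fin: "finite (carrier G)" and p: "prime p" and n: "\<not> p dvd n"
    and exp: "\<And>x. x \<in> carrier G \<Longrightarrow> x [^] (n::nat) = \<one>"
  shows "\<not> p dvd card (carrier G)"
proof
  assume "p dvd card (carrier G)"
  then obtain m where "Coset.order G = p ^ 1 * m" by (auto simp: Coset.order_def)
  then obtain P where P: "subgroup P G" "card P = p"
    using sylow_thm[OF p is_group _ fin, of 1 m] by auto
  interpret P: subgroup P G by fact
  have finP: "finite P" using P fin by (meson finite_subset P.subset)
  have "x = \<one>" if x: "x \<in> P" for x
  proof -
    have c: "x \<in> carrier G" using x by simp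
    have "x [^] p = \<one>" using pow_card_subgroup[OF P(1) finP x] P(2) by simp
    then have "ord x dvd p" using pow_eq_id[OF c] by simp
    moreover have "ord x dvd n" using pow_eq_id[OF c] exp[OF c] by simp
    ultimately have "ord x = 1" using p n by (metis prime_nat_iff)
    then show ?thesis using c by (metis nat_pow_eone pow_ord_eq_1)
  qed
  then have "P = {\<one>}" using P.one_closed by blast
  then show False using P(2) p by auto
qed

lemma (in group) lower_central_subgroup_Suc:
  assumes A: "subgroup A G"
  shows "lower_central (G\<lparr>carrier := A\<rparr>) (Suc i)
    = generate G (\<Union>x\<in>lower_central (G\<lparr>carrier := A\<rparr>) i. \<Union>y\<in>A. {comm x y})"
proof -
  interpret A: subgroup A G by fact
  interpret GA: group "G\<lparr>carrier := A\<rparr>" using A by (rule subgroup_imp_group)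
  let ?L = "lower_central (G\<lparr>carrier := A\<rparr>) i"
  have L: "x \<in> A" if "x \<in> ?L" for x using GA.lower_central_carrier[OF that] by simp
  have eq: "(\<Union>x\<in>?L. \<Union>y\<in>A. {GA.comm x y}) = (\<Union>x\<in>?L. \<Union>y\<in>A. {comm x y})"
    using L by (intro SUP_cong refl) (simp add: m_inv_consistent[OF A])
  have "(\<Union>x\<in>?L. \<Union>y\<in>A. {comm x y}) \<subseteq> A" using L by auto
  then show ?thesis using generate_consistent[OF _ A] eq by (simp add: lower_central.simps(2))
qed

lemma (in group) nilpotent_subgroup:
  assumes A: "subgroup A G" and B: "subgroup B G" "B \<subseteq> A"
    and nil: "nilpotent_group (G\<lparr>carrier := A\<rparr>)"
  shows "nilpotent_group (G\<lparr>carrier := B\<rparr>)"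
proof -
  interpret GB: group "G\<lparr>carrier := B\<rparr>" using B(1) by (rule subgroup_imp_group)
  have sub: "lower_central (G\<lparr>carrier := B\<rparr>) i \<subseteq> lower_central (G\<lparr>carrier := A\<rparr>) i" for i
  proof (induction i)
    case (Suc i)
    then show ?case unfolding lower_central_subgroup_Suc[OF A] lower_central_subgroup_Suc[OF B(1)]
      using B(2) by (intro mono_generate UN_mono) auto
  qed (use B in simp)
  obtain c where "lower_central (G\<lparr>carrier := A\<rparr>) c = {\<one>}"
    using nil by (auto simp: nilpotent_group_def)
  then have "lower_central (G\<lparr>carrier := B\<rparr>) c = {\<one>}"
    using sub[of c] subgroup.one_closed[OF GB.subgroup_lower_central[of c]] by auto
  then show ?thesis using GB.is_group by (auto simp: nilpotent_group_def)
qed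

corollary (in group) nilpotent_generate_torsion:
  assumes S: "S \<subseteq> carrier G" and nil: "nilpotent_group (G\<lparr>carrier := generate G S\<rparr>)"
    and b: "\<And>s. s \<in> S \<Longrightarrow> s [^] (b::nat) = \<one>"
  shows "\<exists>c. \<forall>x\<in>generate G S. x [^] (b ^ c) = \<one>"
    and "finite S \<Longrightarrow> b > 0 \<Longrightarrow> finite (generate G S)"
proof -
  let ?A = "G\<lparr>carrier := generate G S\<rparr>"
  have sub: "subgroup (generate G S) G" using S by (rule generate_is_subgroup)
  then interpret GA: group ?A by (rule subgroup_imp_group)
  have S_incl: "S \<subseteq> generate G S" by (auto intro: generate.incl)
  have gen: "carrier ?A = generate ?A S" using generate_consistent[OF S_incl sub] by simp
  have pow: "x [^]\<^bsub>?A\<^esub> (k::nat) = x [^] k" for x k by (simp add: nat_pow_consistent[symmetric])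
  note * = GA.nilpotent_torsion_generated[OF nil _ gen, of b, unfolded pow]
  show "\<exists>c. \<forall>x\<in>generate G S. x [^] (b ^ c) = \<one>" using *(1) S_incl b by simp
  show "finite (generate G S)" if "finite S" "b > 0" using *(2) S_incl b that by simp
qed

section \<open>Matrices and the general linear group\<close>

lemma GL_simps [simp]:
  "A \<in> carrier GL \<longleftrightarrow> invertible A" "A \<otimes>\<^bsub>GL\<^esub> B = A ** B" "\<one>\<^bsub>GL\<^esub> = mat 1"
  by (simp_all add: GL_def)

lemma matrix_mult_zero [simp]:
  "(0 :: 'a::comm_ring_1 ^ 'n ^ 'n) ** A = 0" "A ** (0 :: 'a ^ 'n ^ 'n) = 0"
  by (simp_all add: vec_eq_iff matrix_matrix_mult_def)

lemma matrix_diff_rdistrib: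
  fixes A B C :: "'a::comm_ring_1 ^ 'n ^ 'n"
  shows "(A - B) ** C = A ** C - B ** C"
  by (simp add: vec_eq_iff matrix_matrix_mult_def sum_subtractf algebra_simps)

lemma matrix_add_rdistrib:
  fixes A B C :: "'a::comm_ring_1 ^ 'n ^ 'n"
  shows "(A + B) ** C = A ** C + B ** C"
  by (simp add: vec_eq_iff matrix_matrix_mult_def sum.distrib algebra_simps)

lemma matrix_sum_ldistrib:
  fixes C :: "'a::comm_ring_1 ^ 'n ^ 'n" and f :: "'i \<Rightarrow> 'a ^ 'n ^ 'n"
  shows "C ** sum f I = (\<Sum>i\<in>I. C ** f i)"
  by (induction I rule: infinite_finite_induct) (simp_all add: matrix_add_ldistrib)

lemma matrix_sum_rdistrib:
  fixes C :: "'a::comm_ring_1 ^ 'n ^ 'n" and f :: "'i \<Rightarrow> 'a ^ 'n ^ 'n"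
  shows "sum f I ** C = (\<Sum>i\<in>I. f i ** C)"
  by (induction I rule: infinite_finite_induct) (simp_all add: matrix_add_rdistrib)

lemma matrix_inv_mult:
  assumes "invertible (A :: 'a::field ^ 'n ^ 'n)"
  shows "matrix_inv A ** A = mat 1" "A ** matrix_inv A = mat 1"
  using assms by (auto simp: invertible_def matrix_inv_def intro: someI2_ex)

interpretation GL: group "GL :: ('a::field ^ 'n ^ 'n) monoid"
  by (rule group_GL)

lemma inv_GL [simp]: "invertible A \<Longrightarrow> inv\<^bsub>GL\<^esub> A = matrix_inv (A :: 'a::field ^ 'n ^ 'n)"
  by (rule GL.inv_equality) (auto simp: invertible_def matrix_inv_def intro: someI2_ex)

section \<open>Matrices of finite order in characteristic p\<close>

text \<open>
  The kernels of the powers of \<open>f\<close> increase strictly until they become stationary, which by dimension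
  happens after at most \<open>n\<close> steps.
\<close>

lemma funpow_linear_eq_0:
  fixes f :: "'a::field ^ 'n \<Rightarrow> 'a ^ 'n"
  assumes f: "Vector_Spaces.linear (*s) (*s) f" and m: "\<And>v. (f ^^ m) v = 0"
  shows "(f ^^ CARD('n)) v = 0"
proof -
  define ker where "ker i = {v. (f ^^ i) v = 0}" for i
  interpret f: Vector_Spaces.linear "(*s)" "(*s)" f by (rule f)
  have f0: "f 0 = 0" using f.zero by simp
  have sub: "vec.subspace (ker i)" for i
  proof -
    have "(f ^^ i) 0 = 0" "(f ^^ i) (v + w) = (f ^^ i) v + (f ^^ i) w"
      "(f ^^ i) (c *s v) = c *s (f ^^ i) v" for v w c
      by (induction i) (simp_all add: f0 f.add f.scale)
    then show ?thesis unfolding ker_def by (intro vec.subspaceI) auto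
  qed
  have mono: "ker i \<subseteq> ker (Suc i)" for i by (auto simp: ker_def f0)
  have stab: "ker (i + k) = ker i" if "ker (Suc i) = ker i" for i k
  proof (induction k)
    case (Suc k)
    have "v \<in> ker (i + k)" if "v \<in> ker (i + Suc k)" for v
    proof -
      have "(f ^^ Suc i) ((f ^^ k) v) = 0"
        using that fun_cong[OF funpow_add[of "Suc i" k f], of v] unfolding ker_def add_Suc_shift
        by (simp del: funpow.simps)
      then have "(f ^^ k) v \<in> ker i" using \<open>ker (Suc i) = ker i\<close> unfolding ker_def by blast
      then show ?thesis unfolding ker_def by (simp add: funpow_add)
    qed
    then show ?case using Suc mono[of "i + k"] by auto
  qed simp
  have "\<exists>i\<le>CARD('n). ker (Suc i) = ker i"
  proof (rule ccontr)
    assume neq: "\<not> ?thesis"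
    have "i \<le> Suc CARD('n) \<Longrightarrow> i \<le> vec.dim (ker i)" for i
    proof (induction i)
      case (Suc i)
      then have "ker i \<noteq> ker (Suc i)" using neq by (metis Suc_le_mono)
      then have "vec.dim (ker i) \<noteq> vec.dim (ker (Suc i))"
        using vec.subspace_dim_equal[OF sub sub mono[of i]] by auto
      moreover have "vec.dim (ker i) \<le> vec.dim (ker (Suc i))" using mono by (rule vec.dim_subset)
      ultimately show ?case using Suc by simp
    qed simp
    from this[of "Suc CARD('n)"] show False
      using vec.dim_subset_UNIV[of "ker (Suc CARD('n))"] vec.dimension_def vec_dim_card
      by (metis Suc_n_not_le_n le_trans order_refl vec.dim_UNIV vec.dim_subset subset_UNIV)
  qed
  then obtain i where i: "i \<le> CARD('n)" "ker (Suc i) = ker i" by blast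
  have "ker j \<subseteq> ker i" for j
  proof (cases "j \<le> i")
    case True
    then show ?thesis using lift_Suc_mono_le[of ker, OF mono] by simp
  next
    case False
    then show ?thesis using stab[OF i(2), of "j - i"] by simp
  qed
  moreover have "ker i \<subseteq> ker CARD('n)" using lift_Suc_mono_le[of ker, OF mono] i(1) by simp
  ultimately have "v \<in> ker CARD('n)" using m by (auto simp: ker_def)
  then show ?thesis by (simp add: ker_def)
qed

text \<open>
  \<open>P(T) v\<close>. Letting polynomials act on vectors makes the binomial theorem of a commutative ring
  available for the powers of a single matrix.
\<close>

definition poly_act :: "'a::field ^ 'n ^ 'n \<Rightarrow> 'a poly \<Rightarrow> 'a ^ 'n \<Rightarrow> 'a ^ 'n" where
  "poly_act T P v = fold_coeffs (\<lambda>a w. a *s v + T *v w) P 0"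

lemma poly_act_0 [simp]: "poly_act T 0 v = 0"
  by (simp add: poly_act_def)

lemma poly_act_pCons: "poly_act T (pCons a P) v = a *s v + T *v poly_act T P v"
  by (cases "a = 0 \<and> P = 0") (auto simp: poly_act_def)

lemma poly_act_add: "poly_act T (P + Q) v = poly_act T P v + poly_act T Q v"
  by (induction P Q rule: poly_induct2)
    (simp_all add: poly_act_pCons vec.add vec.scale_left_distrib)

lemma poly_act_linear:
  "poly_act T P (v + w) = poly_act T P v + poly_act T P w"
  "poly_act T P (c *s v) = c *s poly_act T P v"
  by (induction P) (simp_all add: poly_act_pCons vec.add vec.scale
    vec.scale_right_distrib vec.scale_left_commute)

lemma poly_act_smult: "poly_act T (smult c P) v = c *s poly_act T P v"
  by (induction P) (simp_all add: poly_act_pCons vec.add vec.scale vec.scale_right_distrib)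

lemma poly_act_mult: "poly_act T (P * Q) v = poly_act T P (poly_act T Q v)"
  by (induction P) (simp_all add: poly_act_pCons poly_act_add poly_act_smult)

lemma poly_act_1: "poly_act T 1 v = v"
  by (simp add: one_pCons poly_act_pCons)

lemma poly_act_power: "poly_act T (P ^ k) v = (poly_act T P ^^ k) v"
  by (induction k arbitrary: v) (simp_all add: poly_act_1 poly_act_mult)

lemma poly_act_monom:
  fixes T :: "'a::field ^ 'n ^ 'n"
  assumes "invertible T"
  shows "poly_act T (monom 1 k) v = (T [^]\<^bsub>GL\<^esub> k) *v v"
proof (induction k)
  case (Suc k)
  have "T [^]\<^bsub>GL\<^esub> Suc k = T ** T [^]\<^bsub>GL\<^esub> k" using GL.nat_pow_Suc2[of T k] assms by simp
  then show ?case using Suc by (simp add: monom_Suc poly_act_pCons matrix_vector_mul_assoc)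
qed (simp add: monom_0 poly_act_pCons)

lemma poly_act_diff: "poly_act T (P - Q) v = poly_act T P v - poly_act T Q v"
  using poly_act_add[of T "P - Q" Q v] by (simp add: algebra_simps)

text \<open>
  The \<open>p\<close>-part of \<open>T\<close> is unipotent: \<open>(T^b - 1)^(p^a) = T^(b p^a) - 1 = 0\<close> in characteristic \<open>p\<close>. A nilpotent
  matrix of size \<open>n \<le> p\<^sup>\<gamma>\<close> vanishes already in the power \<open>p\<^sup>\<gamma>\<close>, so \<open>T^(b p^\<gamma>) = 1\<close>. This is why the procedure
  passes to \<open>p\<^sup>\<gamma>\<close>-th powers.
\<close>

lemma prime_power_kills_p_part:
  fixes T :: "'a::field ^ 'n ^ 'n"
  assumes p: "prime p" "CHAR('a) = p" and n: "CARD('n) \<le> p ^ \<gamma>"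
    and T: "invertible T" "T [^]\<^bsub>GL\<^esub> (p ^ a * b) = \<one>\<^bsub>GL\<^esub>"
  shows "(T [^]\<^bsub>GL\<^esub> (p ^ \<gamma>)) [^]\<^bsub>GL\<^esub> b = \<one>\<^bsub>GL\<^esub>"
proof -
  define N where "N = poly_act T (monom 1 b - 1)"
  have N: "(N ^^ p ^ k) v = (T [^]\<^bsub>GL\<^esub> (p ^ k * b)) *v v - v" for k v
  proof -
    have "(monom 1 b - 1 + 1 :: 'a poly) ^ p ^ k = (monom 1 b - 1) ^ p ^ k + 1 ^ p ^ k"
      by (rule freshmans_dream') (use p in simp_all)
    then have "(monom 1 b - 1 :: 'a poly) ^ p ^ k = monom 1 (p ^ k * b) - 1"
      by (simp add: monom_power algebra_simps)
    then show ?thesis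
      unfolding N_def poly_act_power[symmetric]
      by (simp add: poly_act_diff poly_act_1 poly_act_monom[OF T(1)])
  qed
  have lin: "Vector_Spaces.linear (*s) (*s) N"
    unfolding N_def Vector_Spaces.linear_iff by (simp add: poly_act_linear vec.vector_space_axioms)
  have "(N ^^ p ^ a) v = 0" for v using N[of a v] T(2) by simp
  then have "(N ^^ CARD('n)) v = 0" for v by (rule funpow_linear_eq_0[OF lin])
  moreover have "(N ^^ i) 0 = 0" for i
    by (induction i) (simp_all add: N_def poly_act_linear(2)[of T _ 0 0, simplified])
  moreover have "p ^ \<gamma> = (p ^ \<gamma> - CARD('n)) + CARD('n)" using n by simp
  ultimately have "(N ^^ p ^ \<gamma>) v = 0" for v by (metis comp_apply funpow_add)
  then have "(T [^]\<^bsub>GL\<^esub> (p ^ \<gamma> * b)) *v v = mat 1 *v v" for v using N[of \<gamma> v] by simp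
  then have "T [^]\<^bsub>GL\<^esub> (p ^ \<gamma> * b) = mat 1" by (simp add: matrix_eq)
  then show ?thesis using T(1) by (simp add: GL.nat_pow_pow)
qed

section \<open>Reduction on the enveloping algebra of a finite group\<close>

lemma smult_matrix_nth [simp]: "smult_matrix c A $ i $ j = c * A $ i $ j"
  by (simp add: smult_matrix_def)

lemma smult_matrix_mult_left:
  fixes A B :: "'a::comm_ring_1 ^ 'n ^ 'n"
  shows "smult_matrix c A ** B = smult_matrix c (A ** B)"
  by (simp add: vec_eq_iff matrix_matrix_mult_def sum_distrib_left mult.assoc)

lemma smult_matrix_mult_right:
  fixes A B :: "'a::comm_ring_1 ^ 'n ^ 'n"
  shows "A ** smult_matrix c B = smult_matrix c (A ** B)"
  by (simp add: vec_eq_iff matrix_matrix_mult_def sum_distrib_left algebra_simps)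

definition map_mat :: "('a \<Rightarrow> 'b) \<Rightarrow> 'a ^ 'n ^ 'n \<Rightarrow> 'b ^ 'n ^ 'n" where
  "map_mat \<phi> A = (\<chi> i j. \<phi> (A $ i $ j))"

definition mat_over :: "'a set \<Rightarrow> ('a ^ 'n ^ 'n) set" where
  "mat_over R = {A. \<forall>i j. A $ i $ j \<in> R}"

lemma map_mat_nth [simp]: "map_mat \<phi> A $ i $ j = \<phi> (A $ i $ j)"
  by (simp add: map_mat_def)

text \<open>
  A ring homomorphism defined on a subring of a field, as substitution is on the rational functions
  whose denominator does not vanish at the given point.
\<close>

locale partial_ring_hom =
  fixes R :: "'a::field set" and \<phi> :: "'a \<Rightarrow> 'b::field"
  assumes one: "1 \<in> R" "\<phi> 1 = 1"
    and add: "x \<in> R \<Longrightarrow> y \<in> R \<Longrightarrow> x + y \<in> R" "x \<in> R \<Longrightarrow> y \<in> R \<Longrightarrow> \<phi> (x + y) = \<phi> x + \<phi> y"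
    and mult: "x \<in> R \<Longrightarrow> y \<in> R \<Longrightarrow> x * y \<in> R" "x \<in> R \<Longrightarrow> y \<in> R \<Longrightarrow> \<phi> (x * y) = \<phi> x * \<phi> y"
    and uminus: "x \<in> R \<Longrightarrow> - x \<in> R"
begin

lemma zero: "0 \<in> R" "\<phi> 0 = 0"
proof -
  show 0: "0 \<in> R" using add(1)[OF one(1) uminus[OF one(1)]] by simp
  show "\<phi> 0 = 0" using add(2)[OF 0 0] by (metis add_0 add_right_cancel)
qed

lemma uminus_hom: "x \<in> R \<Longrightarrow> \<phi> (- x) = - \<phi> x"
  using add(2)[of x "- x"] uminus zero(2) by (simp add: eq_neg_iff_add_eq_0 add.commute)

lemma diff:
  assumes "x \<in> R" "y \<in> R"
  shows "x - y \<in> R" "\<phi> (x - y) = \<phi> x - \<phi> y"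
  using add[OF assms(1) uminus[OF assms(2)]] uminus_hom[OF assms(2)] by simp_all

lemma sum:
  assumes "\<And>i. i \<in> I \<Longrightarrow> f i \<in> R"
  shows "sum f I \<in> R \<and> \<phi> (sum f I) = (\<Sum>i\<in>I. \<phi> (f i))"
  using assms by (induction I rule: infinite_finite_induct) (auto simp: zero add)

lemma prod:
  assumes "\<And>i. i \<in> I \<Longrightarrow> f i \<in> R"
  shows "prod f I \<in> R \<and> \<phi> (prod f I) = (\<Prod>i\<in>I. \<phi> (f i))"
  using assms by (induction I rule: infinite_finite_induct) (auto simp: one mult)

lemma mat_one: "mat 1 \<in> mat_over R" "map_mat \<phi> (mat 1) = mat 1"
  by (auto simp: mat_over_def mat_def vec_eq_iff one zero)

lemma mat_mult:
  assumes "A \<in> mat_over R" "B \<in> mat_over R"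
  shows "A ** B \<in> mat_over R" "map_mat \<phi> (A ** B) = map_mat \<phi> A ** map_mat \<phi> B"
  using assms sum[of UNIV "\<lambda>k. A $ i $ k * B $ k $ j" for i j]
  by (auto simp: mat_over_def matrix_matrix_mult_def vec_eq_iff mult)

lemma mat_smult:
  assumes "c \<in> R" "A \<in> mat_over R"
  shows "smult_matrix c A \<in> mat_over R" "map_mat \<phi> (smult_matrix c A) = smult_matrix (\<phi> c) (map_mat \<phi> A)"
  using assms by (auto simp: mat_over_def vec_eq_iff mult)

lemma mat_zero: "0 \<in> mat_over R" "map_mat \<phi> 0 = 0"
  by (auto simp: mat_over_def vec_eq_iff zero)

lemma mat_add:
  assumes "A \<in> mat_over R" "B \<in> mat_over R"
  shows "A + B \<in> mat_over R" "map_mat \<phi> (A + B) = map_mat \<phi> A + map_mat \<phi> B"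
  using assms by (auto simp: mat_over_def vec_eq_iff add)

lemma mat_diff:
  assumes "A \<in> mat_over R" "B \<in> mat_over R"
  shows "A - B \<in> mat_over R" "map_mat \<phi> (A - B) = map_mat \<phi> A - map_mat \<phi> B"
  using assms by (auto simp: mat_over_def vec_eq_iff diff)

lemma det_hom:
  assumes "A \<in> mat_over R"
  shows "\<phi> (det A) = det (map_mat \<phi> A)"
proof -
  have sgn: "of_int (sign p) \<in> R \<and> \<phi> (of_int (sign p)) = of_int (sign p)" for p :: "'c \<Rightarrow> 'c"
    by (auto simp: sign_def one uminus uminus_hom)
  have *: "(\<Prod>i\<in>UNIV. A $ i $ p i) \<in> R \<and> \<phi> (\<Prod>i\<in>UNIV. A $ i $ p i) = (\<Prod>i\<in>UNIV. \<phi> (A $ i $ p i))" for p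
    by (rule prod) (use assms in \<open>auto simp: mat_over_def\<close>)
  show ?thesis unfolding det_def using sgn *
    by (subst conjunct2[OF sum]) (auto intro!: mult sum.cong simp: mult)
qed

end

text \<open>
  If \<open>E\<close> reduces to \<open>0\<close>, then \<open>det (1 - E)\<close> reduces to \<open>1\<close>; so \<open>1 - E\<close> is invertible over the field, and
  it annihilates \<open>E\<close>.
\<close>

lemma (in partial_ring_hom) idempotent_eq_0:
  fixes E :: "'a ^ 'n ^ 'n"
  assumes E: "E \<in> mat_over R" "E ** E = E" "map_mat \<phi> E = 0"
  shows "E = 0"
proof -
  let ?D = "mat 1 - E"
  have "?D \<in> mat_over R" "map_mat \<phi> ?D = mat 1"
    using mat_diff[OF mat_one(1) E(1)] E(3) mat_one(2) by simp_all
  then have "\<phi> (det ?D) = 1" using det_hom[of ?D] by simp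
  then have "det ?D \<noteq> 0" using zero(2) by auto
  then obtain D' where "D' ** ?D = mat 1" using invertible_det_nz[of ?D] by (auto simp: invertible_def)
  then have "E = D' ** (?D ** E)" by (simp add: matrix_mul_assoc)
  also have "?D ** E = 0" using E(2) by (simp add: matrix_diff_rdistrib)
  finally show ?thesis by simp
qed

text \<open>
  Reduction is injective on the enveloping algebra \<open>A\<close> of a finite matrix group whose order is
  invertible. Its kernel \<open>J\<close> in \<open>A\<close> is a left ideal. As in Maschke's theorem, averaging a linear
  projection onto \<open>J\<close> over the group gives an \<open>A\<close>-linear projection \<open>\<pi>\<close> of \<open>A\<close> onto \<open>J\<close>. Then
  \<open>\<pi>(y) = y \<pi>(1)\<close>, so \<open>\<pi>(1)\<close> is an idempotent that reduces to \<open>0\<close>, hence is \<open>0\<close>, and \<open>J = 0\<close>.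
\<close>

theorem (in partial_ring_hom) maschke_inj:
  fixes \<iota> :: "'l::field \<Rightarrow> 'a" and H :: "('a ^ 'n ^ 'n) set"
  assumes \<iota>: "\<And>c d. \<iota> (c + d) = \<iota> c + \<iota> d" "\<And>c d. \<iota> (c * d) = \<iota> c * \<iota> d" "\<iota> 1 = 1"
    and \<iota>_R: "\<And>c. \<iota> c \<in> R"
    and H: "subgroup H GL" "finite H" "H \<subseteq> mat_over R"
    and card: "of_nat (card H) \<noteq> (0::'l)"
    and x: "x = lincomb (\<lambda>l. \<iota> (c l)) Bs" "set Bs \<subseteq> H" "map_mat \<phi> x = 0"
  shows "x = 0"
proof -
  let ?s = "\<lambda>c (A :: 'a ^ 'n ^ 'n). smult_matrix (\<iota> c) A"
  interpret V: vector_space ?s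
    by unfold_locales (simp_all add: vec_eq_iff \<iota> algebra_simps)
  interpret VV: vector_space_pair ?s ?s ..
  interpret H: subgroup H GL by fact
  have H_mult: "h ** k \<in> H" if "h \<in> H" "k \<in> H" for h k using H.m_closed[OF that] by simp
  have inv: "invertible h" if "h \<in> H" for h using H.mem_carrier[OF that] by simp
  have H_inv: "matrix_inv h \<in> H" if "h \<in> H" for h
    using H.m_inv_closed[OF that] inv[OF that] by simp
  have minv: "matrix_inv h ** h = mat 1" "h ** matrix_inv h = mat 1" if "h \<in> H" for h
    using matrix_inv_mult[OF inv[OF that]] by auto
  have H1: "mat 1 \<in> H" using H.one_closed by simp
  have lin_left: "Vector_Spaces.linear ?s ?s (\<lambda>A. B ** A)" for B
    unfolding Vector_Spaces.linear_iff
    by (simp add: V.vector_space_axioms matrix_add_ldistrib smult_matrix_mult_right)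
  have lin_right: "Vector_Spaces.linear ?s ?s (\<lambda>A. A ** B)" for B
    unfolding Vector_Spaces.linear_iff
    by (simp add: V.vector_space_axioms matrix_add_rdistrib smult_matrix_mult_left)
  define A where "A = V.span H"
  have A_sub: "V.subspace A" by (simp add: A_def)
  have A_R: "A \<subseteq> mat_over R"
  proof -
    have "V.subspace (mat_over R)"
      by (intro V.subspaceI mat_zero mat_add mat_smult \<iota>_R)
    then show ?thesis using H(3) unfolding A_def by (rule V.span_minimal[rotated])
  qed
  have A_left: "h ** y \<in> A" if "h \<in> H" "y \<in> A" for h y
    using that(2) unfolding A_def
  proof (induction rule: V.span_induct_alt)
    case base
    show ?case using V.span_zero by simp
  next
    case (step c z y)
    then show ?case using H_mult[OF that(1)] V.span_base V.span_add V.span_scale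
      by (simp add: matrix_add_ldistrib smult_matrix_mult_right)
  qed
  define J where "J = {y \<in> A. map_mat \<phi> y = 0}"
  have J_sub: "V.subspace J"
  proof (rule V.subspaceI)
    show "0 \<in> J" unfolding J_def using V.subspace_0[OF A_sub] mat_zero by simp
    show "y + z \<in> J" if "y \<in> J" "z \<in> J" for y z
      using that V.subspace_add[OF A_sub] mat_add(2) A_R unfolding J_def by fastforce
    show "?s c y \<in> J" if "y \<in> J" for c y
      using that V.subspace_scale[OF A_sub] mat_smult(2)[OF \<iota>_R, of y c] A_R
      unfolding J_def by (auto simp: vec_eq_iff)
  qed
  have J_left: "h ** y \<in> J" if "h \<in> H" "y \<in> J" for h y
    using that A_left A_R H(3) mat_mult(2)[of h y] unfolding J_def
    by (auto simp: matrix_matrix_mult_def vec_eq_iff)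
  obtain g where g: "range g \<subseteq> J" "Vector_Spaces.linear ?s ?s g" "\<And>y. y \<in> J \<Longrightarrow> g y = y"
    using VV.linear_exists_left_inverse_on[OF V.linear_ident J_sub]
    by (auto simp: inj_on_def)
  interpret g: Vector_Spaces.linear ?s ?s g by fact
  define \<pi> where "\<pi> y = ?s (inverse (of_nat (card H))) (\<Sum>h\<in>H. h ** g (matrix_inv h ** y))" for y
  have \<pi>_lin: "Vector_Spaces.linear ?s ?s \<pi>"
    unfolding Vector_Spaces.linear_iff \<pi>_def
    by (intro conjI allI V.vector_space_axioms)
      (simp_all add: matrix_add_ldistrib g.add g.scale sum.distrib V.scale_right_distrib
        smult_matrix_mult_right V.scale_sum_right mult.commute)
  have \<pi>_J: "\<pi> y \<in> J" for y
    unfolding \<pi>_def using g(1) by (intro V.subspace_scale[OF J_sub] V.subspace_sum[OF J_sub] J_left) auto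
  have \<pi>_id: "\<pi> y = y" if y: "y \<in> J" for y
  proof -
    have "(\<Sum>h\<in>H. h ** g (matrix_inv h ** y)) = (\<Sum>h\<in>H. y)"
      using y by (intro sum.cong) (simp_all add: g(3) J_left H_inv matrix_mul_assoc minv)
    also have "\<dots> = ?s (of_nat (card H)) y"
      by (rule V.sum_constant_scale)
    finally show ?thesis unfolding \<pi>_def using card by (simp only: V.scale_scale) simp
  qed
  have \<pi>_left: "\<pi> (k ** y) = k ** \<pi> y" if k: "k \<in> H" for k y
  proof -
    have "(\<Sum>h\<in>H. h ** g (matrix_inv h ** (k ** y))) = (\<Sum>h\<in>H. (k ** h) ** g (matrix_inv h ** y))"
    proof (rule sum.reindex_bij_witness[of _ "\<lambda>h. k ** h" "\<lambda>h. matrix_inv k ** h"])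
      fix h assume h: "h \<in> H"
      show "k ** (matrix_inv k ** h) = h" "matrix_inv k ** (k ** h) = h"
        using k by (simp_all add: matrix_mul_assoc minv)
      show "k ** h \<in> H" "matrix_inv k ** h \<in> H" using h k H_mult H_inv by auto
      have "matrix_inv (matrix_inv k ** h) = matrix_inv h ** k"
        using GL.inv_mult_group[of "matrix_inv k" h] inv h k H_inv GL.inv_inv[of k]
        by (simp add: invertible_mult)
      then show "(k ** (matrix_inv k ** h)) ** g (matrix_inv (matrix_inv k ** h) ** y)
          = h ** g (matrix_inv h ** (k ** y))"
        using k by (simp add: matrix_mul_assoc minv)
    qed
    also have "\<dots> = k ** (\<Sum>h\<in>H. h ** g (matrix_inv h ** y))"
      by (simp add: matrix_sum_ldistrib matrix_mul_assoc)
    finally show ?thesis unfolding \<pi>_def by (simp add: smult_matrix_mult_right)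
  qed
  let ?E = "\<pi> (mat 1)"
  have \<pi>_E: "\<pi> y = y ** ?E" if "y \<in> A" for y
  proof (rule VV.linear_eq_on[OF \<pi>_lin lin_right that[unfolded A_def]])
    show "\<pi> k = k ** ?E" if "k \<in> H" for k using \<pi>_left[OF that, of "mat 1"] by simp
  qed
  have E: "?E \<in> J" by (rule \<pi>_J)
  have "?E = 0"
  proof (rule idempotent_eq_0)
    show "?E ** ?E = ?E" using \<pi>_E[of ?E] \<pi>_id[OF E] E by (simp add: J_def)
  qed (use E A_R in \<open>auto simp: J_def\<close>)
  moreover have "x \<in> A" unfolding x(1) A_def lincomb_def
    using x(2) by (intro V.span_sum V.span_scale V.span_base) auto
  then have "x \<in> J" using x(3) by (simp add: J_def)
  then have "x = x ** ?E" using \<pi>_E[of x] \<pi>_id[of x] by (simp add: J_def)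
  ultimately show ?thesis by simp
qed

section \<open>Substitution in rational functions\<close>

lemma (in partial_ring_hom) lincomb_hom:
  assumes "\<And>l. l < length As \<Longrightarrow> c l \<in> R" "set As \<subseteq> mat_over R"
  shows "lincomb c As \<in> mat_over R"
    "map_mat \<phi> (lincomb c As) = lincomb (\<lambda>l. \<phi> (c l)) (map (map_mat \<phi>) As)"
proof -
  have "c l * As ! l $ i $ j \<in> R \<and> \<phi> (c l * As ! l $ i $ j) = \<phi> (c l) * \<phi> (As ! l $ i $ j)"
    if "l < length As" for l i j
    using assms(1)[OF that] nth_mem[OF that] assms(2) mult by (auto simp: mat_over_def)
  then have "(\<Sum>l<length As. c l * As ! l $ i $ j) \<in> R \<and>
      \<phi> (\<Sum>l<length As. c l * As ! l $ i $ j) = (\<Sum>l<length As. \<phi> (c l) * \<phi> (As ! l $ i $ j))"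
    for i j
    using sum[of "{..<length As}" "\<lambda>l. c l * As ! l $ i $ j"] by simp
  then show "lincomb c As \<in> mat_over R"
    "map_mat \<phi> (lincomb c As) = lincomb (\<lambda>l. \<phi> (c l)) (map (map_mat \<phi>) As)"
    by (simp_all add: mat_over_def lincomb_def vec_eq_iff sum_component)
qed

lemma (in partial_ring_hom) word_val_hom:
  assumes "set w \<subseteq> mat_over R"
  shows "word_val w \<in> mat_over R \<and> map_mat \<phi> (word_val w) = word_val (map (map_mat \<phi>) w)"
  using assms by (induction w) (auto simp: word_val_def mat_one mat_mult)

lemma CHAR_ratfun: "CHAR(('m::linorder, 'k::field) ratfun) = CHAR('k)"
proof (rule CHAR_eqI)
  have *: "of_nat n = (0 :: ('m, 'k) ratfun) \<longleftrightarrow> of_nat n = (0 :: 'k)" for n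
  proof -
    have "of_nat n = Fract (Poly_Mapping.single 0 (of_nat n) :: ('m, 'k) mpoly) 1"
      by (simp add: of_nat_fract)
    also have "\<dots> = 0 \<longleftrightarrow> (Poly_Mapping.single 0 (of_nat n) :: ('m, 'k) mpoly) = 0"
      by (simp add: Zero_fract_def eq_fract del: single_of_nat)
    also have "\<dots> \<longleftrightarrow> of_nat n = (0 :: 'k)"
      by (metis lookup_single_eq lookup_zero single_zero)
    finally show ?thesis .
  qed
  show "of_nat CHAR('k) = (0 :: ('m, 'k) ratfun)" using * by simp
  show "CHAR('k) dvd n" if "of_nat n = (0 :: ('m, 'k) ratfun)" for n
    using that unfolding * by (simp add: of_nat_eq_0_iff_char_dvd)
qed

lemma poly_at_zero [simp]: "poly_at 0 \<alpha> = 0"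
  by (simp add: poly_at_def)

lemma poly_at_one [simp]: "poly_at 1 \<alpha> = 1"
  using poly_at_single[of 0 1 \<alpha>] by simp

lemma poly_at_nonzero: "poly_at P \<alpha> \<noteq> 0 \<Longrightarrow> P \<noteq> 0"
  by auto

definition regular_at ::
    "('m \<Rightarrow> 'k alg_closure) \<Rightarrow> ('m::{finite,linorder}, 'k::field) ratfun set" where
  "regular_at \<alpha> = {x. \<exists>a b. x = Fract a b \<and> poly_at b \<alpha> \<noteq> 0}"

lemma regular_atE:
  assumes "x \<in> regular_at \<alpha>"
  obtains a b where "x = Fract a b" "poly_at b \<alpha> \<noteq> 0" "b \<noteq> 0" "ratfun_at x \<alpha> = poly_at a \<alpha> / poly_at b \<alpha>"
  using assms ratfun_at_Fract poly_at_nonzero unfolding regular_at_def by blast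

lemma regular_atI: "poly_at b \<alpha> \<noteq> 0 \<Longrightarrow> Fract a b \<in> regular_at \<alpha>"
  unfolding regular_at_def by blast

interpretation eval: partial_ring_hom "regular_at \<alpha>" "\<lambda>x. ratfun_at x \<alpha>"
  for \<alpha> :: "'m::{finite,linorder} \<Rightarrow> 'k::field alg_closure"
proof
  show "1 \<in> regular_at \<alpha>" "ratfun_at 1 \<alpha> = 1"
    using regular_atI[of 1 \<alpha> 1] ratfun_at_Fract[of 1 \<alpha> 1] by (simp_all add: One_fract_def)
next
  fix x y assume "x \<in> regular_at \<alpha>" "y \<in> regular_at \<alpha>"
  then obtain a b c d where ab: "x = Fract a b" "poly_at b \<alpha> \<noteq> 0" "b \<noteq> 0"
    and cd: "y = Fract c d" "poly_at d \<alpha> \<noteq> 0" "d \<noteq> 0"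
    by (metis regular_atE)
  have bd: "poly_at (b * d) \<alpha> \<noteq> 0" using ab cd by (simp add: poly_at_mult)
  have sum: "x + y = Fract (a * d + c * b) (b * d)" and prod: "x * y = Fract (a * c) (b * d)"
    and uminus: "- x = Fract (- a) b"
    using ab cd by simp_all
  show "x + y \<in> regular_at \<alpha>" "x * y \<in> regular_at \<alpha>" "- x \<in> regular_at \<alpha>"
    unfolding sum prod uminus using bd ab by (auto intro: regular_atI)
  show "ratfun_at (x + y) \<alpha> = ratfun_at x \<alpha> + ratfun_at y \<alpha>"
    unfolding sum using ab cd bd
    by (simp add: ratfun_at_Fract poly_at_add poly_at_mult add_frac_eq del: add_fract)
  show "ratfun_at (x * y) \<alpha> = ratfun_at x \<alpha> * ratfun_at y \<alpha>"
    unfolding prod using ab cd bd by (simp add: ratfun_at_Fract poly_at_mult)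
qed

lemma map_coeffs_to_ac_one [simp]: "map_coeffs to_ac 1 = 1"
  using map_coeffs_to_ac_single[of 0 1] by simp

interpretation ext: partial_ring_hom UNIV "ratfun_to_ac :: ('m::linorder, 'k::field) ratfun \<Rightarrow> _"
proof
  show "ratfun_to_ac 1 = (1 :: ('m, 'k alg_closure) ratfun)"
    by (simp add: One_fract_def ratfun_to_ac_Fract)
next
  fix x y :: "('m, 'k) ratfun"
  obtain a b c d where ab: "x = Fract a b" "b \<noteq> 0" and cd: "y = Fract c d" "d \<noteq> 0"
    by (metis Fract_cases)
  then show "ratfun_to_ac (x + y) = ratfun_to_ac x + ratfun_to_ac y"
    "ratfun_to_ac (x * y) = ratfun_to_ac x * ratfun_to_ac y"
    by (simp_all add: ratfun_to_ac_Fract map_coeffs_to_ac_add map_coeffs_to_ac_mult)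
qed auto

interpretation to_ac: partial_ring_hom UNIV "to_ac :: 'k::field \<Rightarrow> _"
  by unfold_locales auto

lemma ratfun_to_ac_inj: "inj ratfun_to_ac"
proof (rule injI)
  fix x y :: "('a::linorder, 'b::field) ratfun"
  assume eq: "ratfun_to_ac x = ratfun_to_ac y"
  obtain a b where ab: "x - y = Fract a b" "b \<noteq> 0" by (metis Fract_cases)
  have "ratfun_to_ac (x - y) = 0" using eq ext.diff(2)[of x y] by simp
  then have "map_coeffs to_ac a = 0"
    using ab by (simp add: ratfun_to_ac_Fract Zero_fract_def eq_fract)
  then have "x - y = 0" using ab by (simp add: Zero_fract_def eq_fract)
  then show "x = y" by simp
qed

lemma poly_at_map_coeffs:
  "poly_at (map_coeffs to_ac P) (\<lambda>i. to_ac (\<alpha> i)) = to_ac (poly_at P \<alpha>)"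
  by (induction P rule: mpoly_induct)
    (simp_all add: map_coeffs_to_ac_single map_coeffs_to_ac_add poly_at_single poly_at_add to_ac_prod)

text \<open>
  Over \<open>F(X)\<close>, with \<open>F\<close> the algebraic closure, substitution takes values in the algebraic closure of
  \<open>F\<close>, formally a new field. Embedding the point there makes substitution compatible with the
  extension of scalars, so both levels share one evaluation map.
\<close>

lemma ratfun_at_to_ac:
  assumes "x \<in> regular_at \<alpha>"
  shows "ratfun_to_ac x \<in> regular_at (\<lambda>i. to_ac (\<alpha> i))"
    and "ratfun_at (ratfun_to_ac x) (\<lambda>i. to_ac (\<alpha> i)) = to_ac (ratfun_at x \<alpha>)"
proof -
  obtain a b where ab: "x = Fract a b" "poly_at b \<alpha> \<noteq> 0" "b \<noteq> 0" using assms by (rule regular_atE)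
  then have "poly_at (map_coeffs to_ac b) (\<lambda>i. to_ac (\<alpha> i)) \<noteq> 0" by (simp add: poly_at_map_coeffs)
  then show "ratfun_to_ac x \<in> regular_at (\<lambda>i. to_ac (\<alpha> i))"
    "ratfun_at (ratfun_to_ac x) (\<lambda>i. to_ac (\<alpha> i)) = to_ac (ratfun_at x \<alpha>)"
    using ab by (simp_all add: ratfun_to_ac_Fract regular_atI ratfun_at_Fract poly_at_map_coeffs)
qed

lemma const_ratfun_hom [simp]:
  "const_ratfun (c + d) = const_ratfun c + const_ratfun d"
  "const_ratfun (c * d) = const_ratfun c * const_ratfun d"
  "const_ratfun 1 = 1"
  by (simp_all add: const_ratfun_def single_add mult_single One_fract_def)

lemma const_ratfun_regular: "const_ratfun c \<in> regular_at \<alpha>"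
  and const_ratfun_at: "ratfun_at (const_ratfun c) \<alpha> = to_ac c"
  by (simp_all add: const_ratfun_def regular_atI ratfun_at_Fract poly_at_single)

lemma mat_at_eq: "mat_at M \<alpha> = map_mat (\<lambda>x. ratfun_at x \<alpha>) M"
  by (simp add: mat_at_def map_mat_def)

lemma mat_to_ac_eq: "mat_to_ac M = map_mat ratfun_to_ac M"
  by (simp add: mat_to_ac_def map_mat_def)

lemma mat_over_UNIV [simp]: "mat_over UNIV = UNIV"
  by (simp add: mat_over_def)

lemma mat_to_ac_mult: "mat_to_ac (A ** B) = mat_to_ac A ** mat_to_ac B"
  using ext.mat_mult(2)[of A B] by (simp add: mat_to_ac_eq)

lemma mat_to_ac_one: "mat_to_ac (mat 1) = mat 1"
  using ext.mat_one(2) by (simp add: mat_to_ac_eq)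

lemma mat_to_ac_inj: "inj mat_to_ac"
  by (intro injI) (simp add: mat_to_ac_def vec_eq_iff inj_eq[OF ratfun_to_ac_inj])

lemma mat_at_to_ac:
  assumes "M \<in> mat_over (regular_at \<alpha>)"
  shows "mat_to_ac M \<in> mat_over (regular_at (\<lambda>i. to_ac (\<alpha> i)))"
    and "mat_at (mat_to_ac M) (\<lambda>i. to_ac (\<alpha> i)) = map_mat to_ac (mat_at M \<alpha>)"
  using assms by (auto simp: mat_over_def mat_to_ac_def mat_at_def vec_eq_iff ratfun_at_to_ac[where \<alpha> = \<alpha>])

section \<open>Linear combinations over a subfield\<close>

text \<open>
  The relations of the procedure have coefficients in a finite subfield, which is a set of elements
  of the algebraic closure rather than a type.
\<close>

locale subfield_set =
  fixes K :: "'a::field set"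
  assumes one: "1 \<in> K"
    and add: "x \<in> K \<Longrightarrow> y \<in> K \<Longrightarrow> x + y \<in> K"
    and mult: "x \<in> K \<Longrightarrow> y \<in> K \<Longrightarrow> x * y \<in> K"
    and uminus: "x \<in> K \<Longrightarrow> - x \<in> K"
    and inverse: "x \<in> K \<Longrightarrow> inverse x \<in> K"
begin

lemma zero: "0 \<in> K"
  using add[OF one uminus[OF one]] by simp

lemma divide: "x \<in> K \<Longrightarrow> y \<in> K \<Longrightarrow> x / y \<in> K"
  using mult inverse by (simp add: divide_inverse)

lemma sum: "(\<And>i. i \<in> I \<Longrightarrow> f i \<in> K) \<Longrightarrow> sum f I \<in> K"
  by (induction I rule: infinite_finite_induct) (auto intro: zero add)

lemma prod: "(\<And>i. i \<in> I \<Longrightarrow> f i \<in> K) \<Longrightarrow> prod f I \<in> K"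
  by (induction I rule: infinite_finite_induct) (auto intro: one mult)

lemma power: "x \<in> K \<Longrightarrow> x ^ n \<in> K"
  by (induction n) (auto intro: one mult)

end

lemma subfield_setI:
  assumes "subfield K (ring_of_type_algebra :: 'a::field ring)"
  shows "subfield_set K"
proof -
  define R where "R = (ring_of_type_algebra :: 'a ring)"
  interpret R: field R unfolding R_def by (rule field_from_type_algebra)
  have R_simps [simp]: "carrier R = UNIV" "\<one>\<^bsub>R\<^esub> = 1" "\<zero>\<^bsub>R\<^esub> = 0"
    "x \<otimes>\<^bsub>R\<^esub> y = x * y" "x \<oplus>\<^bsub>R\<^esub> y = x + y" for x y
    by (simp_all add: R_def ring_of_type_algebra_def)
  have minus [simp]: "\<ominus>\<^bsub>R\<^esub> x = - x" for x
    by (rule R.minus_equality) auto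
  have inv [simp]: "inv\<^bsub>R\<^esub> x = inverse x" if "x \<noteq> 0" for x
    using that by (intro R.comm_inv_char) auto
  note K = assms[folded R_def]
  note S = subfieldE(1)[OF K]
  show ?thesis
  proof
    show "inverse x \<in> K" if "x \<in> K" for x
      using R.subfield_m_inv(1)[OF K, of x] that by (cases "x = 0") auto
  qed (use subringE(3,5,6,7)[OF S] in auto)
qed

lemma lincomb_cong:
  assumes "\<And>l. l < length Bs \<Longrightarrow> c l = d l"
  shows "lincomb c Bs = lincomb d Bs"
  using assms by (simp add: lincomb_def)

lemma lincomb_add: "lincomb c Bs + lincomb d Bs = lincomb (\<lambda>l. c l + d l) Bs"
  by (simp add: lincomb_def vec_eq_iff sum.distrib distrib_right)

lemma lincomb_smult:
  fixes k :: "'a::comm_ring_1"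
  shows "smult_matrix k (lincomb c Bs) = lincomb (\<lambda>l. k * c l) Bs"
  by (simp add: lincomb_def vec_eq_iff sum_component sum_distrib_left mult.assoc)

lemma lincomb_zero: "lincomb (\<lambda>_. 0) Bs = 0"
  by (simp add: lincomb_def vec_eq_iff)

lemma lincomb_snoc:
  "lincomb c (Bs @ [B]) = lincomb c Bs + smult_matrix (c (length Bs)) B"
  by (simp add: lincomb_def nth_append)

lemma lincomb_Cons:
  "lincomb c (B # Bs) = smult_matrix (c 0) B + lincomb (\<lambda>l. c (Suc l)) Bs"
  unfolding lincomb_def by (simp add: sum.lessThan_Suc_shift del: sum.lessThan_Suc)

lemma lincomb_unit:
  assumes "i < length Bs"
  shows "lincomb (\<lambda>l. if l = i then 1 else 0) Bs = Bs ! i"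
proof -
  have "(if l = i then 1 else 0) * x = (if l = i then x else 0)" for l and x :: 'a
    by simp
  then show ?thesis using assms
    by (simp add: lincomb_def vec_eq_iff sum_component sum.delta')
qed

lemma lincomb_mult_right:
  fixes T :: "'a::comm_ring_1 ^ 'n ^ 'n"
  shows "lincomb c Bs ** T = lincomb c (map (\<lambda>B. B ** T) Bs)"
  by (simp add: lincomb_def matrix_sum_rdistrib smult_matrix_mult_left)

definition list_span :: "'a::semiring_1 set \<Rightarrow> ('a ^ 'n ^ 'n) list \<Rightarrow> ('a ^ 'n ^ 'n) set" where
  "list_span K Bs = {lincomb c Bs | c. \<forall>l<length Bs. c l \<in> K}"

definition subspace_over :: "'a::field set \<Rightarrow> ('a ^ 'n ^ 'n) set \<Rightarrow> bool" where
  "subspace_over K W \<longleftrightarrow> 0 \<in> W \<and> (\<forall>A\<in>W. \<forall>B\<in>W. A + B \<in> W) \<and> (\<forall>c\<in>K. \<forall>A\<in>W. smult_matrix c A \<in> W)"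

lemma lincomb_in_subspace:
  assumes W: "subspace_over K W" and "set Bs \<subseteq> W" "\<forall>l<length Bs. c l \<in> K"
  shows "lincomb c Bs \<in> W"
proof -
  have sum: "sum f I \<in> W" if "\<And>i. i \<in> I \<Longrightarrow> f i \<in> W" for f :: "nat \<Rightarrow> _" and I
    using that W by (induction I rule: infinite_finite_induct) (auto simp: subspace_over_def)
  show ?thesis unfolding lincomb_def
  proof (rule sum)
    fix l assume "l \<in> {..<length Bs}"
    then have "Bs ! l \<in> W" "c l \<in> K" using assms(2,3) by auto
    then show "smult_matrix (c l) (Bs ! l) \<in> W" using W by (simp add: subspace_over_def)
  qed
qed

context subfield_set
begin

lemma subspace_list_span: "subspace_over K (list_span K Bs)"
  unfolding subspace_over_def list_span_def
proof (intro conjI ballI)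
  show "0 \<in> {lincomb c Bs |c. \<forall>l<length Bs. c l \<in> K}"
    using zero by (auto intro!: exI[of _ "\<lambda>_. 0"] simp: lincomb_zero)
  fix A B k assume "A \<in> {lincomb c Bs |c. \<forall>l<length Bs. c l \<in> K}"
  then obtain a where a: "A = lincomb a Bs" "\<forall>l<length Bs. a l \<in> K" by blast
  show "smult_matrix k A \<in> {lincomb c Bs |c. \<forall>l<length Bs. c l \<in> K}" if "k \<in> K"
    unfolding a(1) lincomb_smult using a(2) mult[OF that] by blast
  assume "B \<in> {lincomb c Bs |c. \<forall>l<length Bs. c l \<in> K}"
  then obtain b where "B = lincomb b Bs" "\<forall>l<length Bs. b l \<in> K" by blast
  then show "A + B \<in> {lincomb c Bs |c. \<forall>l<length Bs. c l \<in> K}"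
    using a add by (auto simp: lincomb_add)
qed

lemma list_span_superset: "set Bs \<subseteq> list_span K Bs"
proof
  fix B assume "B \<in> set Bs"
  then obtain i where i: "i < length Bs" "B = Bs ! i" by (auto simp: in_set_conv_nth)
  then show "B \<in> list_span K Bs"
    using one zero lincomb_unit[OF i(1)] unfolding list_span_def
    by (intro CollectI exI[of _ "\<lambda>l. if l = i then 1 else 0"]) auto
qed

lemma span_over_minimal:
  assumes "subspace_over K W" "B \<subseteq> W"
  shows "span_over K B \<subseteq> W"
  using lincomb_in_subspace[OF assms(1)] assms(2) unfolding span_over_def by blast

lemma span_over_set: "span_over K (set Bs) = list_span K Bs"
  using span_over_minimal[OF subspace_list_span list_span_superset]
  by (auto simp: span_over_def list_span_def)

end

lemma span_over_mono: "A \<subseteq> B \<Longrightarrow> span_over K A \<subseteq> span_over K B"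
  unfolding span_over_def by blast

lemma finite_list_span:
  assumes "finite K"
  shows "finite (list_span K Bs)"
proof -
  have "list_span K Bs \<subseteq> (\<lambda>c. lincomb c Bs) ` (PiE {..<length Bs} (\<lambda>_. K))"
  proof
    fix A assume "A \<in> list_span K Bs"
    then obtain c where c: "A = lincomb c Bs" "\<forall>l<length Bs. c l \<in> K" by (auto simp: list_span_def)
    then have "A = lincomb (restrict c {..<length Bs}) Bs"
      by (auto intro!: lincomb_cong)
    then show "A \<in> (\<lambda>c. lincomb c Bs) ` (PiE {..<length Bs} (\<lambda>_. K))"
      using c(2) by (intro image_eqI[of _ _ "restrict c {..<length Bs}"]) auto
  qed
  then show ?thesis by (rule finite_subset) (use assms in \<open>auto intro!: finite_PiE\<close>)
qed

lemma finite_mat_over: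
  assumes "finite K"
  shows "finite (mat_over K :: ('a ^ 'n ^ 'n) set)"
proof -
  have fin: "finite {v :: 'b ^ 'n. \<forall>i. v $ i \<in> X'}" if "finite X'" for X' :: "'b set"
  proof -
    have "{v :: 'b ^ 'n. \<forall>i. v $ i \<in> X'} \<subseteq> vec_lambda ` (PiE UNIV (\<lambda>_. X'))"
      by (auto intro!: image_eqI[of _ vec_lambda, OF vec_lambda_eta[symmetric]])
    then show ?thesis by (rule finite_subset) (use that in \<open>auto intro!: finite_PiE\<close>)
  qed
  have "mat_over K = {A :: 'a ^ 'n ^ 'n. \<forall>i. A $ i \<in> {v. \<forall>j. v $ j \<in> K}}"
    by (simp add: mat_over_def)
  also have "finite \<dots>" by (intro fin assms)
  finally show ?thesis .
qed

section \<open>Runs of the procedure\<close>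

lemma subfield_set_poly_at:
  fixes \<alpha> :: "'m::finite \<Rightarrow> 'k::field alg_closure"
  assumes "subfield_set L" "range to_ac \<subseteq> L" "range \<alpha> \<subseteq> L"
  shows "poly_at P \<alpha> \<in> L"
proof -
  interpret L: subfield_set L by fact
  show ?thesis unfolding poly_at_def
    using assms(2,3) by (intro L.sum L.mult L.prod L.power) auto
qed

definition indep_over :: "'a::semiring_1 set \<Rightarrow> ('a ^ 'n ^ 'n) list \<Rightarrow> bool" where
  "indep_over K Bs \<longleftrightarrow>
     (\<forall>c. (\<forall>l<length Bs. c l \<in> K) \<longrightarrow> lincomb c Bs = 0 \<longrightarrow> (\<forall>l<length Bs. c l = 0))"

lemma (in subfield_set) indep_over_snoc:
  assumes indep: "indep_over K Bs" and B: "B \<notin> list_span K Bs"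
  shows "indep_over K (Bs @ [B])"
  unfolding indep_over_def
proof (intro allI impI)
  fix c l
  assume c: "\<forall>l<length (Bs @ [B]). c l \<in> K" and eq: "lincomb c (Bs @ [B]) = 0"
    and l: "l < length (Bs @ [B])"
  let ?d = "c (length Bs)"
  have d: "?d = 0"
  proof (rule ccontr)
    assume "?d \<noteq> 0"
    have "lincomb c Bs = - smult_matrix ?d B" using eq unfolding lincomb_snoc by (rule eq_neg_iff_add_eq_0[THEN iffD2])
    then have "smult_matrix (- inverse ?d) (lincomb c Bs) = B"
      using \<open>?d \<noteq> 0\<close> by (simp add: vec_eq_iff)
    then have "B = lincomb (\<lambda>l. - inverse ?d * c l) Bs" by (simp add: lincomb_smult)
    moreover have "- inverse ?d * c l \<in> K" if "l < length Bs" for l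
      using c that by (intro mult uminus inverse) auto
    ultimately show False using B unfolding list_span_def by blast
  qed
  have "lincomb c Bs = 0" using eq unfolding lincomb_snoc d by (simp add: smult_matrix_def vec_eq_iff)
  then have "\<forall>l<length Bs. c l = 0" using indep c by (simp add: indep_over_def)
  then show "c l = 0" using l d by (auto simp: less_Suc_eq)
qed

lemma const_ratfun_zero [simp]: "const_ratfun 0 = 0"
  by (simp add: const_ratfun_def Zero_fract_def)

lemma const_ratfun_uminus: "const_ratfun (- c) = - const_ratfun c"
  using const_ratfun_hom(1)[of c "- c"] by (simp del: const_ratfun_hom add: eq_neg_iff_add_eq_0 add.commute)

lemma (in subfield_set) subfield_set_const: "subfield_set (const_ratfun ` K)"
proof
  show "inverse x \<in> const_ratfun ` K" if x: "x \<in> const_ratfun ` K" for x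
  proof -
    obtain c where c: "x = const_ratfun c" "c \<in> K" using x by blast
    have "inverse (const_ratfun c) = const_ratfun (inverse c)"
    proof (cases "c = 0")
      case False
      then have "const_ratfun c * const_ratfun (inverse c) = 1"
        unfolding const_ratfun_hom(2)[symmetric] by simp
      then show ?thesis by (rule inverse_unique)
    qed simp
    then show ?thesis using c inverse by auto
  qed
  show "- x \<in> const_ratfun ` K" if "x \<in> const_ratfun ` K" for x
    using that uminus by (auto simp flip: const_ratfun_uminus)
  show "1 \<in> const_ratfun ` K"
    using one const_ratfun_hom(3) by (rule image_eqI[rotated, OF _ sym])
  show "x + y \<in> const_ratfun ` K" "x * y \<in> const_ratfun ` K"
    if "x \<in> const_ratfun ` K" "y \<in> const_ratfun ` K" for x y
    using that add mult by (auto simp flip: const_ratfun_hom)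
qed

lemma group_hom_mat_to_ac: "group_hom GL GL mat_to_ac"
proof (intro group_hom.intro group_hom_axioms.intro group_GL homI)
  fix A B :: "('a::linorder, 'b::field) ratfun ^ 'n ^ 'n"
  show "mat_to_ac (A \<otimes>\<^bsub>GL\<^esub> B) = mat_to_ac A \<otimes>\<^bsub>GL\<^esub> mat_to_ac B" by (simp add: mat_to_ac_mult)
  show "mat_to_ac A \<in> carrier GL" if A: "A \<in> carrier GL"
  proof -
    obtain B where "A ** B = mat 1" "B ** A = mat 1" using A by (auto simp: invertible_def)
    then have "mat_to_ac A ** mat_to_ac B = mat 1" "mat_to_ac B ** mat_to_ac A = mat 1"
      by (simp_all flip: mat_to_ac_mult add: mat_to_ac_one)
    then show ?thesis by (auto simp: invertible_def)
  qed
qed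

lemma generate_GL:
  "mat 1 \<in> generate GL A"
  "B \<in> generate GL A \<Longrightarrow> C \<in> generate GL A \<Longrightarrow> B ** C \<in> generate GL A"
  using generate.one generate.eng by (metis GL_simps(3), metis GL_simps(2))

locale procedure_run = subfield_set K
  for K :: "'k::field alg_closure set" +
  fixes \<alpha> :: "'m::{finite,linorder} \<Rightarrow> 'k alg_closure"
    and \<T> :: "(('m, 'k) ratfun ^ 'n ^ 'n) set"
  assumes finite_K: "finite K" and to_ac_K: "range to_ac \<subseteq> K" and \<alpha>_K: "range \<alpha> \<subseteq> K"
    and \<T>: "\<T> \<subseteq> carrier GL"
    and regular: "\<And>T. T \<in> \<T> \<Longrightarrow> T \<in> mat_over (regular_at \<alpha>)"
      "\<And>T. T \<in> \<T> \<Longrightarrow> matrix_inv T \<in> mat_over (regular_at \<alpha>)"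
begin

abbreviation H :: "(('m, 'k) ratfun ^ 'n ^ 'n) set" where
  "H \<equiv> generate GL \<T>"

lemma subgroup_H: "subgroup H GL"
  using \<T> by (rule GL.generate_is_subgroup)

lemma \<T>_invertible: "T \<in> \<T> \<Longrightarrow> invertible T"
  using \<T> by auto

lemma mat_at_mult:
  "A \<in> mat_over (regular_at \<alpha>) \<Longrightarrow> B \<in> mat_over (regular_at \<alpha>) \<Longrightarrow>
    mat_at (A ** B) \<alpha> = mat_at A \<alpha> ** mat_at B \<alpha>"
  unfolding mat_at_eq by (rule eval.mat_mult)

lemma mat_at_one: "mat_at (mat 1) \<alpha> = mat 1"
  by (simp add: mat_at_eq eval.mat_one)

lemma mat_at_inverse:
  assumes "T \<in> \<T>"
  shows "invertible (mat_at T \<alpha>)" "matrix_inv (mat_at T \<alpha>) = mat_at (matrix_inv T) \<alpha>"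
proof -
  have *: "mat_at T \<alpha> ** mat_at (matrix_inv T) \<alpha> = mat 1" "mat_at (matrix_inv T) \<alpha> ** mat_at T \<alpha> = mat 1"
    using matrix_inv_mult[OF \<T>_invertible[OF assms]] regular[OF assms] mat_at_one
    by (simp_all flip: mat_at_mult)
  then show "invertible (mat_at T \<alpha>)" unfolding invertible_def by blast
  then show "matrix_inv (mat_at T \<alpha>) = mat_at (matrix_inv T) \<alpha>"
    using * GL.inv_equality[of "mat_at (matrix_inv T) \<alpha>" "mat_at T \<alpha>"]
    by (metis GL_simps inv_GL invertible_def)
qed

lemma H_regular:
  assumes "M \<in> H"
  shows "M \<in> mat_over (regular_at \<alpha>) \<and> mat_at M \<alpha> \<in> generate GL ((\<lambda>T. mat_at T \<alpha>) ` \<T>)"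
  using assms
proof (induction rule: generate.induct)
  case one
  show ?case by (simp add: eval.mat_one mat_at_one generate_GL)
next
  case (incl T)
  then show ?case using regular by (auto intro: generate.incl)
next
  case (inv T)
  then show ?case
    using regular generate.inv[of "mat_at T \<alpha>" "(\<lambda>T. mat_at T \<alpha>) ` \<T>" GL] mat_at_inverse \<T>_invertible
    by simp
next
  case (eng A B)
  then show ?case using eval.mat_mult(1) mat_at_mult generate_GL(2) by fastforce
qed

lemma mat_at_K:
  assumes "M \<in> mat_over (regular_at \<alpha>)"
  shows "mat_at M \<alpha> \<in> mat_over K"
proof -
  have "ratfun_at x \<alpha> \<in> K" if "x \<in> regular_at \<alpha>" for x
    using that to_ac_K \<alpha>_K divide
    subfield_set_poly_at[OF subfield_set_axioms] by (metis regular_atE)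
  then show ?thesis using assms by (auto simp: mat_at_def mat_over_def)
qed

lemma word_val_H: "set w \<subseteq> \<T> \<Longrightarrow> word_val w \<in> H"
proof (induction w)
  case Nil
  show ?case by (simp add: word_val_def generate_GL)
next
  case (Cons T w)
  then show ?case using generate.eng[of T GL \<T> "word_val w"] generate.incl[of T \<T> GL]
    by (simp add: word_val_def)
qed

lemma word_at: "set w \<subseteq> \<T> \<Longrightarrow> word_at \<alpha> w = mat_at (word_val w) \<alpha>"
  using eval.word_val_hom[of w \<alpha>] regular(1) by (auto simp: word_at_def mat_at_eq subset_iff)

text \<open>
  The invariants of the two loops of the procedure: the words adjoined so far take linearly
  independent values at \<open>\<alpha>\<close>; when adjoining ends, the span of these values is closed under right
  multiplication by the generators.
\<close>

definition basis_words :: "(('m, 'k) ratfun ^ 'n ^ 'n) list list \<Rightarrow> bool" where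
  "basis_words ws \<longleftrightarrow> [] \<in> set ws \<and> (\<forall>w\<in>set ws. set w \<subseteq> \<T>) \<and> distinct (map (word_at \<alpha>) ws)
     \<and> indep_over K (map (word_at \<alpha>) ws)"

definition closed_words :: "(('m, 'k) ratfun ^ 'n ^ 'n) list list \<Rightarrow> bool" where
  "closed_words ws \<longleftrightarrow> (\<forall>w\<in>set ws. \<forall>T\<in>\<T>. word_at \<alpha> w ** mat_at T \<alpha> \<in> list_span K (map (word_at \<alpha>) ws))"

fun state_inv :: "(('m, 'k) ratfun ^ 'n ^ 'n) state \<Rightarrow> bool" where
  "state_inv Start \<longleftrightarrow> True"
| "state_inv (Adjoining ws) \<longleftrightarrow> basis_words ws"
| "state_inv (Checking ws) \<longleftrightarrow> basis_words ws \<and> closed_words ws"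
| "state_inv (Returned b) \<longleftrightarrow> True"

lemma span_words: "span_over K (word_at \<alpha> ` set ws) = list_span K (map (word_at \<alpha>) ws)"
  using span_over_set[of "map (word_at \<alpha>) ws"] by simp

lemma word_at_snoc:
  assumes "set w \<subseteq> \<T>" "T \<in> \<T>"
  shows "word_at \<alpha> (w @ [T]) = word_at \<alpha> w ** mat_at T \<alpha>"
proof -
  have "foldr (**) (map f w) (A ** B) = foldr (**) (map f w) A ** B"
    for f :: "('m, 'k) ratfun ^ 'n ^ 'n \<Rightarrow> _" and A B
    by (induction w) (simp_all add: matrix_mul_assoc)
  from this[of _ "mat 1"] show ?thesis by (simp add: word_at_def word_val_def)
qed

lemma step_inv: "step K \<alpha> \<T> s s' \<Longrightarrow> state_inv s \<Longrightarrow> state_inv s'"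
proof (induction rule: step.induct)
  case distinct
  have "lincomb c [mat 1 :: 'k alg_closure ^ 'n ^ 'n] = smult_matrix (c 0) (mat 1)" for c
    by (simp add: lincomb_def)
  then show ?case
    by (auto simp: basis_words_def indep_over_def word_at_def word_val_def smult_matrix_def mat_def vec_eq_iff
        split: if_splits)
next
  case (adjoin w ws T)
  let ?Bs = "map (word_at \<alpha>) ws"
  have w: "set w \<subseteq> \<T>" using adjoin by (auto simp: basis_words_def)
  have new: "word_at \<alpha> (w @ [T]) \<notin> list_span K ?Bs"
    using adjoin by (simp add: span_words word_at_snoc[OF w])
  then have "word_at \<alpha> (w @ [T]) \<notin> set ?Bs" using list_span_superset by blast
  then show ?case using adjoin w indep_over_snoc[OF _ new] by (auto simp: basis_words_def)
next
  case (adjoining_done ws)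
  then show ?case by (simp add: closed_words_def span_words)
qed auto

lemma reachable_inv: "(step K \<alpha> \<T>)\<^sup>*\<^sup>* Start s \<Longrightarrow> state_inv s"
  by (induction rule: rtranclp_induct) (auto intro: step_inv)

lemma closed_lincomb:
  assumes "closed_words ws" "k < length ws" "T \<in> \<T>"
  obtains a where "\<forall>l<length ws. a l \<in> K"
    "word_at \<alpha> (ws ! k) ** mat_at T \<alpha> = lincomb a (map (word_at \<alpha>) ws)"
proof -
  have "word_at \<alpha> (ws ! k) ** mat_at T \<alpha> \<in> list_span K (map (word_at \<alpha>) ws)"
    using assms nth_mem unfolding closed_words_def by blast
  then show ?thesis using that unfolding list_span_def by auto
qed

text \<open>
  The final span \<open>W\<close> contains \<open>1\<close>, is finite, and is closed under right multiplication by the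
  generators; so it contains the group that they generate. Conversely it is spanned by values of
  words, which lie in the image of \<open>H\<close>.
\<close>

theorem checking_basis:
  assumes basis_words: "basis_words ws" and closed: "closed_words ws"
  shows "is_basis_over K (map (word_at \<alpha>) ws) (span_over K ((\<lambda>M. mat_at M \<alpha>) ` H))"
proof -
  let ?Bs = "map (word_at \<alpha>) ws"
  let ?W = "list_span K ?Bs"
  have W: "subspace_over K ?W" by (rule subspace_list_span)
  have mat1: "mat 1 \<in> ?W"
    using basis_words list_span_superset[of ?Bs] by (force simp: basis_words_def word_at_def word_val_def)
  have W_closed: "A ** mat_at T \<alpha> \<in> ?W" if A: "A \<in> ?W" and T: "T \<in> \<T>" for A T
  proof -
    obtain c where c: "A = lincomb c ?Bs" "\<forall>l<length ?Bs. c l \<in> K"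
      using A by (auto simp: list_span_def)
    have "lincomb c (map (\<lambda>B. B ** mat_at T \<alpha>) ?Bs) \<in> ?W"
      using closed T c(2) by (intro lincomb_in_subspace[OF W]) (auto simp: closed_words_def)
    then show ?thesis by (simp only: c(1) lincomb_mult_right)
  qed
  have "generate GL ((\<lambda>T. mat_at T \<alpha>) ` \<T>) \<subseteq> ?W \<inter> carrier GL"
  proof (rule GL.finite_generate_closed)
    show "finite (?W \<inter> carrier GL)" using finite_list_span[OF finite_K] by blast
    show "\<one>\<^bsub>GL\<^esub> \<in> ?W \<inter> carrier GL" using mat1 GL.one_closed by simp
    show "(\<lambda>T. mat_at T \<alpha>) ` \<T> \<subseteq> carrier GL" using mat_at_inverse by auto
    show "c \<otimes>\<^bsub>GL\<^esub> a \<in> ?W \<inter> carrier GL" if "a \<in> (\<lambda>T. mat_at T \<alpha>) ` \<T>" "c \<in> ?W \<inter> carrier GL" for a c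
      using that W_closed mat_at_inverse by (auto intro!: invertible_mult)
  qed simp
  then have "(\<lambda>M. mat_at M \<alpha>) ` H \<subseteq> ?W" using H_regular by blast
  then have "span_over K ((\<lambda>M. mat_at M \<alpha>) ` H) \<subseteq> ?W" by (rule span_over_minimal[OF W])
  moreover have "set ?Bs \<subseteq> (\<lambda>M. mat_at M \<alpha>) ` H"
    using basis_words word_at word_val_H by (fastforce simp: basis_words_def)
  then have "?W \<subseteq> span_over K ((\<lambda>M. mat_at M \<alpha>) ` H)"
    unfolding span_over_set[symmetric] by (rule span_over_mono)
  ultimately show ?thesis
    using basis_words span_over_set[of ?Bs] unfolding is_basis_over_def basis_words_def indep_over_def by blast
qed

lemma basis_words_length:
  assumes "basis_words ws"
  shows "length ws \<le> card (mat_over K :: ('k alg_closure ^ 'n ^ 'n) set)"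
proof -
  have "set (map (word_at \<alpha>) ws) \<subseteq> mat_over K"
    using assms mat_at_K H_regular word_at word_val_H by (fastforce simp: basis_words_def)
  then have "card (set (map (word_at \<alpha>) ws)) \<le> card (mat_over K :: ('k alg_closure ^ 'n ^ 'n) set)"
    by (intro card_mono finite_mat_over finite_K)
  then show ?thesis using assms distinct_card[of "map (word_at \<alpha>) ws"] by (simp add: basis_words_def)
qed

text \<open>
  The adjoined values are distinct matrices over the finite field \<open>K\<close>; this bounds the number of words
  and makes the procedure terminate. The offsets make every change of phase a strict descent, even
  when the bound on the number of words is attained.
\<close>

fun fuel :: "(('m, 'k) ratfun ^ 'n ^ 'n) state \<Rightarrow> nat" where
  "fuel Start = card (mat_over K :: ('k alg_closure ^ 'n ^ 'n) set) + 3"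
| "fuel (Adjoining ws) = card (mat_over K :: ('k alg_closure ^ 'n ^ 'n) set) + 2 - length ws"
| "fuel (Checking ws) = 1"
| "fuel (Returned b) = 0"

lemma step_fuel:
  assumes "step K \<alpha> \<T> s s'" "state_inv s"
  shows "fuel s' < fuel s"
  using assms(1,2) step_inv[OF assms]
proof (induction rule: step.induct)
  case (adjoin w ws T)
  then show ?case using basis_words_length[of "ws @ [w @ [T]]"] by simp
next
  case (adjoining_done ws)
  then show ?case using basis_words_length[of ws] by simp
qed auto

lemma progress:
  assumes "state_inv s" "\<nexists>s'. step K \<alpha> \<T> s s'"
  obtains b where "s = Returned b"
proof (cases s)
  case Start
  then show ?thesis using assms(2) step.not_distinct step.distinct by blast
next
  case (Adjoining ws)
  show ?thesis
  proof (cases "\<forall>w\<in>set ws. \<forall>T\<in>\<T>. word_at \<alpha> w ** mat_at T \<alpha> \<in> span_over K (word_at \<alpha> ` set ws)")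
    case True
    then show ?thesis using assms(2) step.adjoining_done Adjoining by metis
  next
    case False
    then show ?thesis using assms(2) step.adjoin Adjoining by metis
  qed
next
  case (Checking ws)
  have "step K \<alpha> \<T> s (Returned True)"
    unfolding Checking
  proof (rule step.relations_hold, intro allI impI ballI)
    fix k T assume k: "k < length ws" and T: "T \<in> \<T>"
    obtain a where a: "\<forall>l<length ws. a l \<in> K"
      "word_at \<alpha> (ws ! k) ** mat_at T \<alpha> = lincomb a (map (word_at \<alpha>) ws)"
      using closed_lincomb[OF _ k T] assms(1) Checking by auto
    then have "mat_to_ac (word_val (ws ! k) ** T)
        = lincomb (\<lambda>l. const_ratfun (a l)) (map (\<lambda>w. mat_to_ac (word_val w)) ws)"
      using assms(2) step.relation_fails[OF k T a] Checking by blast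
    then show "\<exists>a. (\<forall>l<length ws. a l \<in> K) \<and>
       word_at \<alpha> (ws ! k) ** mat_at T \<alpha> = lincomb a (map (word_at \<alpha>) ws) \<and>
       mat_to_ac (word_val (ws ! k) ** T)
         = lincomb (\<lambda>l. const_ratfun (a l)) (map (\<lambda>w. mat_to_ac (word_val w)) ws)"
      using a by blast
  qed
  then show ?thesis using assms(2) by blast
qed (rule that)

theorem procedure_returnsI:
  assumes "\<And>s. state_inv s \<Longrightarrow> \<not> step K \<alpha> \<T> s (Returned (\<not> b))"
  shows "procedure_returns K \<alpha> \<T> b"
  unfolding procedure_returns_def
proof (intro conjI allI impI notI)
  assume "\<exists>\<sigma>. \<sigma> 0 = Start \<and> (\<forall>i. step K \<alpha> \<T> (\<sigma> i) (\<sigma> (Suc i)))"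
  then obtain \<sigma> where \<sigma>: "\<sigma> 0 = Start" "\<And>i. step K \<alpha> \<T> (\<sigma> i) (\<sigma> (Suc i))" by blast
  have inv: "state_inv (\<sigma> i)" for i
    by (induction i) (use \<sigma> step_inv in auto)
  have "fuel (\<sigma> i) + i \<le> fuel (\<sigma> 0)" for i
  proof (induction i)
    case (Suc i)
    then show ?case using step_fuel[OF \<sigma>(2) inv, of i] by linarith
  qed simp
  from this[of "Suc (fuel (\<sigma> 0))"] show False by simp
next
  fix s assume s: "(step K \<alpha> \<T>)\<^sup>*\<^sup>* Start s" "\<nexists>s'. step K \<alpha> \<T> s s'"
  obtain b' where b': "s = Returned b'" using progress[OF reachable_inv[OF s(1)] s(2)] .
  from s(1) obtain s' where "(step K \<alpha> \<T>)\<^sup>*\<^sup>* Start s'" "step K \<alpha> \<T> s' s"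
    by (cases rule: rtranclp.cases) (use b' in auto)
  then have "b' = b" using assms reachable_inv b' by (cases b; cases b') auto
  then show "s = Returned b" using b' by simp
qed

text \<open>
  If all relations hold, the \<open>K\<close>-span of the matrices \<open>A\<^sub>l\<close> over the rational functions is closed under
  right multiplication by the generators. It is finite because \<open>K\<close> is, so the generated group is finite.
\<close>

theorem returned_true_finite:
  assumes step: "step K \<alpha> \<T> s (Returned True)" and "state_inv s"
  shows "finite H"
  using step
proof (cases rule: step.cases)
  case (relations_hold ws)
  let ?Bs = "map (\<lambda>w. mat_to_ac (word_val w)) ws"
  let ?K = "const_ratfun ` K :: ('m, 'k alg_closure) ratfun set"
  let ?W = "list_span ?K ?Bs"
  interpret L: subfield_set ?K by (rule subfield_set_const)
  have W: "subspace_over ?K ?W" by (rule L.subspace_list_span)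
  have basis_words: "basis_words ws" using assms(2) relations_hold by simp
  have W_closed: "mat_to_ac (M ** T) \<in> ?W" if M: "mat_to_ac M \<in> ?W" and T: "T \<in> \<T>" for M T
  proof -
    obtain c where c: "mat_to_ac M = lincomb c ?Bs" "\<forall>l<length ?Bs. c l \<in> ?K"
      using M by (auto simp: list_span_def)
    have "B ** mat_to_ac T \<in> ?W" if B: "B \<in> set ?Bs" for B
    proof -
      obtain k where k: "k < length ws" "B = mat_to_ac (word_val (ws ! k))"
        using B by (auto simp: in_set_conv_nth)
      then obtain a where a: "\<forall>l<length ws. a l \<in> K"
        "mat_to_ac (word_val (ws ! k) ** T) = lincomb (\<lambda>l. const_ratfun (a l)) ?Bs"
        using relations_hold(2) T by blast
      show ?thesis unfolding k(2) mat_to_ac_mult[symmetric] a(2) list_span_def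
        using a(1) by (intro CollectI exI[of _ "\<lambda>l. const_ratfun (a l)"]) simp
    qed
    then have "lincomb c (map (\<lambda>B. B ** mat_to_ac T) ?Bs) \<in> ?W"
      using c(2) by (intro lincomb_in_subspace[OF W]) auto
    then show ?thesis by (simp only: c(1) lincomb_mult_right mat_to_ac_mult)
  qed
  let ?C = "{M \<in> carrier GL. mat_to_ac M \<in> ?W} :: (('m, 'k) ratfun ^ 'n ^ 'n) set"
  have fin: "finite ?C"
  proof (rule finite_subset)
    show "?C \<subseteq> mat_to_ac -` ?W" by auto
    show "finite (mat_to_ac -` ?W)"
      using finite_K by (intro finite_vimageI finite_list_span mat_to_ac_inj) simp
  qed
  have "H \<subseteq> ?C"
  proof (rule GL.finite_generate_closed[OF fin])
    have "mat_to_ac (mat 1) \<in> set ?Bs"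
      using basis_words by (force simp: basis_words_def word_val_def)
    then show "\<one>\<^bsub>GL\<^esub> \<in> ?C" using L.list_span_superset[of ?Bs] GL.one_closed by auto
    show "c \<otimes>\<^bsub>GL\<^esub> T \<in> ?C" if "T \<in> \<T>" "c \<in> ?C" for T c
      using that W_closed \<T>_invertible by (auto intro!: invertible_mult)
  qed (use \<T> in auto)
  then show ?thesis using fin by (rule finite_subset)
qed simp_all

text \<open>
  Linear relations between elements of \<open>H\<close> lift from their values at \<open>\<alpha>\<close> to the matrices themselves,
  by injectivity of reduction on the enveloping algebra of a group whose order is prime to the
  characteristic. Equality of two values is the special case
  of a relation with coefficients \<open>1, -1\<close>.
\<close>

lemma lift_relation:
  assumes H: "finite H" "of_nat (card H) \<noteq> (0 :: 'k alg_closure)"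
    and Ms: "set Ms \<subseteq> H" "lincomb c (map (\<lambda>M. mat_at M \<alpha>) Ms) = 0"
  shows "lincomb (\<lambda>l. const_ratfun (c l)) (map mat_to_ac Ms) = 0"
proof -
  let ?\<alpha> = "\<lambda>i. to_ac (\<alpha> i)"
  let ?H = "mat_to_ac ` H"
  interpret E: group_hom GL GL mat_to_ac by (rule group_hom_mat_to_ac)
  have reg: "?H \<subseteq> mat_over (regular_at ?\<alpha>)" using H_regular mat_at_to_ac(1) by blast
  have mat_at_M: "mat_at (mat_to_ac M) ?\<alpha> = map_mat to_ac (mat_at M \<alpha>)" if "M \<in> set Ms" for M
    using that Ms(1) H_regular mat_at_to_ac(2) by blast
  show ?thesis
  proof (rule eval.maschke_inj[where \<iota> = const_ratfun and H = ?H and \<alpha> = ?\<alpha> and c = c])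
    show "subgroup ?H GL" using subgroup_H by (rule E.subgroup_img_is_subgroup)
    show "finite ?H" using H(1) by simp
    show "of_nat (card ?H) \<noteq> (0 :: 'k alg_closure)"
      using H(2) card_image[OF inj_on_subset[OF mat_to_ac_inj subset_UNIV], of H] by simp
    show "set (map mat_to_ac Ms) \<subseteq> ?H" using Ms(1) by auto
    have "map_mat (\<lambda>x. ratfun_at x ?\<alpha>) (lincomb (\<lambda>l. const_ratfun (c l)) (map mat_to_ac Ms))
        = lincomb (\<lambda>l. to_ac (c l)) (map (map_mat to_ac) (map (\<lambda>M. mat_at M \<alpha>) Ms))"
      using reg Ms(1) mat_at_M
      by (subst eval.lincomb_hom(2))
        (auto simp: const_ratfun_regular const_ratfun_at mat_at_eq[symmetric] intro!: arg_cong[of _ _ "lincomb _"])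
    also have "\<dots> = map_mat to_ac (lincomb c (map (\<lambda>M. mat_at M \<alpha>) Ms))"
      by (subst to_ac.lincomb_hom(2)) auto
    also have "\<dots> = 0" unfolding Ms(2) by (rule to_ac.mat_zero)
    finally show "map_mat (\<lambda>x. ratfun_at x ?\<alpha>) (lincomb (\<lambda>l. const_ratfun (c l)) (map mat_to_ac Ms)) = 0" .
  qed (use reg const_ratfun_regular in auto)
qed

theorem not_returned_false:
  assumes H: "finite H" "of_nat (card H) \<noteq> (0 :: 'k alg_closure)"
    and inv: "state_inv s"
  shows "\<not> step K \<alpha> \<T> s (Returned False)"
proof
  assume "step K \<alpha> \<T> s (Returned False)"
  then show False
  proof (cases rule: step.cases)
    case not_distinct
    have "M = N" if "M \<in> \<T>" "N \<in> \<T>" "mat_at M \<alpha> = mat_at N \<alpha>" for M N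
    proof -
      have "lincomb (case_nat 1 (\<lambda>_. - 1)) (map (\<lambda>M. mat_at M \<alpha>) [M, N]) = 0"
        using that(3) by (simp add: lincomb_Cons) (simp add: lincomb_def vec_eq_iff)
      moreover have "set [M, N] \<subseteq> H" using that by (auto intro: generate.incl)
      ultimately have "lincomb (\<lambda>l. const_ratfun (case_nat 1 (\<lambda>_. - 1) l)) (map mat_to_ac [M, N]) = 0"
        by (intro lift_relation[OF H])
      then have "mat_to_ac M = mat_to_ac N"
        by (simp add: lincomb_Cons) (simp add: lincomb_def vec_eq_iff const_ratfun_uminus)
      then show ?thesis by (rule injD[OF mat_to_ac_inj])
    qed
    then show ?thesis using not_distinct by (auto simp: inj_on_def)
  next
    case (relation_fails k ws T a)
    let ?M = "word_val (ws ! k) ** T"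
    let ?Ms = "?M # map word_val ws"
    let ?c = "case_nat 1 (\<lambda>l. - a l)"
    have words: "set w \<subseteq> \<T>" if "w \<in> set ws" for w
      using inv relation_fails(1) that by (auto simp: basis_words_def)
    have k: "set (ws ! k) \<subseteq> \<T>" using words relation_fails(2) by simp
    have reg: "word_val (ws ! k) \<in> mat_over (regular_at \<alpha>)" using H_regular word_val_H k by blast
    have M: "?M \<in> H" using generate.eng[OF word_val_H[OF k] generate.incl[OF relation_fails(3)]] by simp
    have words_at: "map (\<lambda>w. mat_at (word_val w) \<alpha>) ws = map (word_at \<alpha>) ws"
      using words word_at by auto
    have "mat_at ?M \<alpha> = lincomb a (map (word_at \<alpha>) ws)"
      using relation_fails(3,5) reg regular(1) word_at[OF k] by (simp add: mat_at_mult)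
    then have "lincomb ?c (map (\<lambda>M. mat_at M \<alpha>) ?Ms) = 0"
      by (simp add: lincomb_Cons o_def words_at) (simp add: lincomb_def vec_eq_iff sum_component sum_negf)
    moreover have "set ?Ms \<subseteq> H" using M words word_val_H by auto
    ultimately have "lincomb (\<lambda>l. const_ratfun (?c l)) (map mat_to_ac ?Ms) = 0"
      by (intro lift_relation[OF H])
    then have "mat_to_ac ?M = lincomb (\<lambda>l. const_ratfun (a l)) (map (\<lambda>w. mat_to_ac (word_val w)) ws)"
      by (simp add: lincomb_Cons o_def)
        (simp add: lincomb_def vec_eq_iff sum_component sum_negf const_ratfun_uminus)
    then show ?thesis using relation_fails(6) by simp
  qed simp_all
qed

end

section \<open>Correctness of the procedure\<close>

lemma CHAR_finite_field:
  assumes "prime p" "CARD('k::{field,finite}) = p ^ e"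
  shows "CHAR('k) = p"
proof -
  have "CHAR('k) dvd p ^ e" using CHAR_dvd_CARD[where 'a = 'k] assms(2) by simp
  moreover have "prime CHAR('k)"
    by (rule prime_CHAR_semidom) (rule finite_imp_CHAR_pos, simp)
  ultimately show ?thesis using assms(1) prime_dvd_power primes_dvd_imp_eq by blast
qed

lemma admissible_regular:
  assumes "admissible \<T> \<alpha>" "T \<in> \<T>" "M \<in> {T, matrix_inv T}"
  shows "M \<in> mat_over (regular_at \<alpha>)"
proof -
  obtain f where f: "common_denominator \<T> f" "poly_at f \<alpha> \<noteq> 0"
    using assms(1) by (auto simp: admissible_def)
  have "M $ i $ j \<in> regular_at \<alpha>" for i j
  proof (cases "M $ i $ j = 0")
    case True
    then show ?thesis using eval.zero(1) by simp
  next
    case False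
    then obtain a b where ab: "M $ i $ j = Fract a b" "b dvd f"
      using bspec[OF bspec[OF conjunct2[OF f(1)[unfolded common_denominator_def]] assms(2)] assms(3)]
      by metis
    then obtain c where "f = b * c" by (elim dvdE)
    then have "poly_at b \<alpha> \<noteq> 0" using f(2) by (auto simp: poly_at_mult)
    then show ?thesis unfolding ab(1) by (rule regular_atI)
  qed
  then show ?thesis by (simp add: mat_over_def)
qed

theorem mainTheorem3:
  fixes p q e \<gamma> \<nu> :: nat
    and S S' G :: "(('m::{finite,linorder}, 'k::{field,finite}) ratfun ^ 'n ^ 'n) set"
    and \<alpha> :: "'m \<Rightarrow> 'k alg_closure"
  assumes "prime p" and "e > 0" and "q = p ^ e" and "CARD('k) = q"
    and "finite S" and "S \<subseteq> carrier GL"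
    and "G = generate GL S" and "nilpotent_group (GL\<lparr>carrier := G\<rparr>)"
    and "real p powi (int \<gamma> - 1) < real CARD('n)" and "CARD('n) \<le> p ^ \<gamma>"
    and "S' = (\<lambda>T. T [^]\<^bsub>GL\<^esub> (p ^ \<gamma>)) ` S"
    and "admissible S' \<alpha>"
    and "\<nu> > 0" and "adjoin_tuple \<alpha> = Fq_ext \<nu>"
  shows "(\<forall>ws. (step (Fq_ext \<nu>) \<alpha> S')\<^sup>*\<^sup>* Start (Checking ws) \<longrightarrow>
            is_basis_over (Fq_ext \<nu>) (map (word_at \<alpha>) ws)
              (span_over (Fq_ext \<nu>) ((\<lambda>M. mat_at M \<alpha>) ` generate GL S')))
       \<and> (finite G \<longrightarrow> procedure_returns (Fq_ext \<nu>) \<alpha> S' True)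
       \<and> (infinite G \<longrightarrow> procedure_returns (Fq_ext \<nu>) \<alpha> S' False)"
proof -
  let ?K = "Fq_ext \<nu> :: 'k alg_closure set"
  have q: "CARD('k) = p ^ e" using assms(3,4) by simp
  have char: "CHAR('k) = p" using assms(1) q by (rule CHAR_finite_field)
  note K = Fq_ext[OF assms(1) q assms(13)]
  have S'_incl: "S' \<subseteq> carrier GL"
    unfolding assms(11) using assms(6) GL.nat_pow_closed by blast
  interpret procedure_run ?K \<alpha> S'
  proof (intro procedure_run.intro procedure_run_axioms.intro)
    show "subfield_set ?K" using K(2) by (rule subfield_setI)
    show "finite ?K" by (rule card_ge_0_finite) (simp add: K(3))
    show "range to_ac \<subseteq> ?K" "range \<alpha> \<subseteq> ?K"
      unfolding assms(14)[symmetric] adjoin_tuple_def by (auto intro: generate_field.incl)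
    show "T \<in> mat_over (regular_at \<alpha>)" "matrix_inv T \<in> mat_over (regular_at \<alpha>)" if "T \<in> S'" for T
      using admissible_regular[OF assms(12) that] by auto
  qed (rule S'_incl)
  have G: "subgroup G GL" unfolding assms(7) using assms(6) by (rule GL.generate_is_subgroup)
  have "T [^]\<^bsub>GL\<^esub> k \<in> G" if "T \<in> S" for T and k :: nat
    unfolding assms(7)
  proof (induction k)
    case (Suc k)
    then show ?case using generate.incl[OF that] unfolding GL.nat_pow_Suc by (rule generate.eng)
  qed (simp add: generate_GL)
  then have "S' \<subseteq> G" unfolding assms(11) by blast
  then have H_G: "H \<subseteq> G" using G by (rule GL.generate_subgroup_incl)
  have nil_H: "nilpotent_group (GL\<lparr>carrier := H\<rparr>)"
    using GL.nilpotent_subgroup[OF G subgroup_H H_G assms(8)] .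
  show ?thesis
  proof (intro conjI allI impI)
    fix ws assume "(step ?K \<alpha> S')\<^sup>*\<^sup>* Start (Checking ws)"
    then have "state_inv (Checking ws)" by (rule reachable_inv)
    then show "is_basis_over ?K (map (word_at \<alpha>) ws) (span_over ?K ((\<lambda>M. mat_at M \<alpha>) ` H))"
      by (intro checking_basis) auto
  next
    assume fin: "finite G"
    \<comment> \<open>With \<open>b\<close> the part of the order of \<open>G\<close> prime to \<open>p\<close>, every element of \<open>S'\<close> is killed by \<open>b\<close>.\<close>
    have "card G > 0" using fin subgroup.one_closed[OF G] card_gt_0_iff by blast
    then obtain b where b: "card G = p ^ multiplicity p (card G) * b" "\<not> p dvd b"
      using multiplicity_decompose'[of "card G" p] assms(1) by (metis not_prime_unit less_irrefl)
    have "T [^]\<^bsub>GL\<^esub> b = \<one>\<^bsub>GL\<^esub>" if T: "T \<in> S'" for T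
    proof -
      obtain U where U: "U \<in> S" "T = U [^]\<^bsub>GL\<^esub> (p ^ \<gamma>)" using T assms(11) by blast
      have "U [^]\<^bsub>GL\<^esub> card G = \<one>\<^bsub>GL\<^esub>"
        using U(1) assms(7) by (intro GL.pow_card_subgroup G fin) (auto intro: generate.incl)
      then show ?thesis unfolding U(2)
        using U(1) assms(6) char b(1)
        by (intro prime_power_kills_p_part[OF assms(1) _ assms(10), of U "multiplicity p (card G)"])
          (auto simp: CHAR_ratfun)
    qed
    note tors = GL.nilpotent_generate_torsion[OF S'_incl nil_H this]
    have finH: "finite H" using fin H_G by (rule finite_subset[rotated])
    obtain c where c: "\<And>x. x \<in> H \<Longrightarrow> x [^]\<^bsub>GL\<^esub> (b ^ c) = \<one>\<^bsub>GL\<^esub>" using tors(1) by blast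
    interpret GH: group "GL\<lparr>carrier := H\<rparr>" using subgroup_H by (rule GL.subgroup_imp_group)
    have "\<not> p dvd card (carrier (GL\<lparr>carrier := H\<rparr>))"
    proof (rule GH.prime_not_dvd_order[OF _ assms(1), of "b ^ c"])
      show "\<not> p dvd b ^ c" using b(2) assms(1) prime_dvd_power by blast
    qed (use finH c in \<open>auto simp: GL.nat_pow_consistent[symmetric]\<close>)
    then have "of_nat (card H) \<noteq> (0 :: 'k alg_closure)"
      by (simp add: of_nat_eq_0_iff_char_dvd char)
    from not_returned_false[OF finH this] show "procedure_returns ?K \<alpha> S' True"
      by (intro procedure_returnsI) simp
  next
    assume inf: "infinite G"
    have "infinite H"
    proof
      assume fin: "finite H"
      define b where "b = p ^ \<gamma> * card H"
      have "card H > 0" using fin subgroup.one_closed[OF subgroup_H] card_gt_0_iff by blast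
      then have "b > 0" using assms(1) prime_gt_0_nat by (simp add: b_def)
      moreover have "T [^]\<^bsub>GL\<^esub> b = \<one>\<^bsub>GL\<^esub>" if T: "T \<in> S" for T
      proof -
        have "T [^]\<^bsub>GL\<^esub> (p ^ \<gamma>) \<in> H" using T assms(11) by (auto intro: generate.incl)
        then have "(T [^]\<^bsub>GL\<^esub> (p ^ \<gamma>)) [^]\<^bsub>GL\<^esub> card H = \<one>\<^bsub>GL\<^esub>"
          by (rule GL.pow_card_subgroup[OF subgroup_H fin])
        then show ?thesis using T assms(6) unfolding b_def by (subst (asm) GL.nat_pow_pow) auto
      qed
      ultimately have "finite (generate GL S)"
        using GL.nilpotent_generate_torsion(2)[OF assms(6) assms(8)[unfolded assms(7)]] assms(5) by blast
      then show False using inf assms(7) by simp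
    qed
    then show "procedure_returns ?K \<alpha> S' False"
      using returned_true_finite by (intro procedure_returnsI) auto
  qed
qed

end
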